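(* Let $\boldsymbol U_h=(\tilde\sigma_h,\tilde\mu_h,\tilde\omega_h)^{\intercal}\in\mathcal P_1(\boldsymbol W_h)$ be the solution of the fully discrete problem $$\int_0^T\left(\langle\boldsymbol U_{h,t},\boldsymbol V_h\rangle+\langle\mathcal A_h\boldsymbol U_h,\boldsymbol V_h\rangle\right)dt=\int_0^T\langle\boldsymbol F,\boldsymbol V_h\rangle\,dt\qquad\forall\,\boldsymbol V_h\in\mathcal P_0(\boldsymbol W_h),$$ where $\boldsymbol F=(0,f,0)^{\intercal}$. Assume $f\in L^\infty((0,T),L^2\Lambda)$. Then $$\max_{0\le i\le N}\|\boldsymbol U_h^i\|\le\|\boldsymbol U_h^0\|+2\int_0^T\|\boldsymbol F\|\,dt.$$ When $\boldsymbol F=0$, the inequality becomes an equality and there is energy conservation: $\|\boldsymbol U_h^i\|=\|\boldsymbol U_h^0\|$ for all $1\le i\le N$.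
   Context: Let $n\ge2$, let $\Omega\subset\mathbb R^n$ be a bounded domain homeomorphic to a ball with piecewise smooth Lipschitz boundary, $T>0$ finite, and fix $0\le k\le n$. $L^2\Lambda^j$ is the space of $L^2$ differential $j$-forms on $\Omega$ with inner product $\langle\cdot,\cdot\rangle$ and norm $\|\cdot\|$ (product inner products and norms for triples). $d$ is the exterior derivative, $H\Lambda^j=\{\omega\in L^2\Lambda^j:d\omega\in L^2\Lambda^{j+1}\}$, and $H_0\Lambda^j=\{\omega\in H\Lambda^j:\mathrm{tr}\,\omega=0\text{ on }\partial\Omega\}$. Superscripts $-$, none, $+$ refer to form degrees $k-1,k,k+1$; spaces of forms of degree $-1$ or $n+1$ are $\{0\}$. Subscript $t$ denotes the time derivative. Finite element spaces: $\mathcal T_h$ is a shape regular triangulation of $\Omega$. $\mathcal P_s\Lambda^j$ denotes polynomial $j$-forms with coefficients of degree $\le s$, $\mathcal H_s\Lambda^j$ those with homogeneous coefficients of degree $s$, and $\mathcal P_s^-\Lambda^j=\mathcal P_{s-1}\Lambda^j+\kappa\mathcal H_{s-1}\Lambda^{j+1}$, where $(\kappa\omega)_x(v_1,\dots,v_{j})=\omega_x(x,v_1,\dots,v_{j})$ for a $(j+1)$-form $\omega$. $V_h^j$ is the space of forms in $H_0\Lambda^j$ whose restriction to each simplex $K\in\mathcal T_h$ lies in $\mathcal P_s\Lambda^j(K)$ (degree $s$ decreasing by one as $j$ increases by one) or, alternatively, in $\mathcal P_s^-\Lambda^j(K)$ (same $s$ for all $j$), so that $V_h^-\to V_h\to V_h^+$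 is a subcomplex of $H_0\Lambda^-\to H_0\Lambda\to H_0\Lambda^+$; $\boldsymbol W_h=V_h^-\times V_h\times V_h^+$. The discrete coderivative $\delta_h:V_h\to V_h^-$ is defined by $\langle\delta_h\omega_h,v_h\rangle=\langle\omega_h,d^-v_h\rangle$ for all $v_h\in V_h^-$; $\delta_h^+:V_h^+\to V_h$ is its analogue in degree $k+1$. On $\boldsymbol W_h$, $$\mathcal A_h=\begin{pmatrix}0&-\delta_h&0\\ d^-&0&\delta_h^+\\ 0&-d&0\end{pmatrix}.$$ Time discretization: $\Delta t=T/N$, $t_i=i\Delta t$ for $0\le i\le N$, and $v^i=v(t_i)$. $\mathcal P_1(\boldsymbol W_h)$ is the set of $\boldsymbol W_h$-valued functions on $[0,T]$ that are continuous and piecewise linear in $t$ with respect to the intervals $(t_{i-1},t_i)$; $\mathcal P_0(\boldsymbol W_h)$ is the set of $\boldsymbol W_h$-valued functions piecewise constant in $t$ on these intervals. The initial value $\boldsymbol U_h^0\in\boldsymbol W_h$ is given. *)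

theory Defs
  imports "HOL-Analysis.Analysis"
begin

section \<open>Domains\<close>

primrec Ck_fun :: "nat \<Rightarrow> ('a::real_normed_vector \<Rightarrow> real) \<Rightarrow> bool" where
  "Ck_fun 0 f \<longleftrightarrow> continuous_on UNIV f"
| "Ck_fun (Suc m) f \<longleftrightarrow>
     (\<forall>x. f differentiable (at x)) \<and> (\<forall>v. Ck_fun m (\<lambda>x. frechet_derivative f (at x) v))"

definition smooth_fun :: "('a::real_normed_vector \<Rightarrow> real) \<Rightarrow> bool" where
  "smooth_fun f \<longleftrightarrow> (\<forall>m. Ck_fun m f)"

definition test_fun :: "'a::euclidean_space set \<Rightarrow> ('a \<Rightarrow> real) \<Rightarrow> bool" where
  "test_fun \<Omega> \<psi> \<longleftrightarrow>
     smooth_fun \<psi> \<and> compact (closure {x. \<psi> x \<noteq> 0}) \<and> closure {x. \<psi> x \<noteq> 0} \<subseteq> \<Omega>"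

text \<open>Near each boundary point the domain is the strict subgraph, in the direction of a unit vector
  \<open>e\<close>, of a Lipschitz function on the hyperplane orthogonal to \<open>e\<close>.\<close>

definition lipschitz_boundary :: "'a::euclidean_space set \<Rightarrow> bool" where
  "lipschitz_boundary \<Omega> \<longleftrightarrow>
     (\<forall>x\<in>frontier \<Omega>. \<exists>r>0. \<exists>e. \<exists>g::'a \<Rightarrow> real. \<exists>L. norm e = 1 \<and> L-lipschitz_on {z. z \<bullet> e = 0} g \<and>
        (\<forall>y\<in>ball x r. y \<in> \<Omega> \<longleftrightarrow> y \<bullet> e < g (y - (y \<bullet> e) *\<^sub>R e)))"

text \<open>The boundary is a finite union of compact pieces, each lying in a smooth hypersurface (the
  zero set of a smooth function whose differential does not vanish on the piece).\<close>

definition piecewise_smooth_boundary :: "'a::euclidean_space set \<Rightarrow> bool" where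
  "piecewise_smooth_boundary \<Omega> \<longleftrightarrow>
     (\<exists>\<S>. finite \<S> \<and> \<Union>\<S> = frontier \<Omega> \<and>
       (\<forall>S\<in>\<S>. compact S \<and>
         (\<exists>g. smooth_fun g \<and> (\<forall>x\<in>S. g x = 0 \<and> (\<exists>v. frechet_derivative g (at x) v \<noteq> 0)))))"

definition admissible_domain :: "'a::euclidean_space set \<Rightarrow> bool" where
  "admissible_domain \<Omega> \<longleftrightarrow>
     open \<Omega> \<and> connected \<Omega> \<and> \<Omega> \<noteq> {} \<and> bounded \<Omega> \<and> \<Omega> homeomorphic (ball 0 1 :: 'a set) \<and>
     lipschitz_boundary \<Omega> \<and> piecewise_smooth_boundary \<Omega>"


section \<open>Differential forms\<close>

text \<open>An alternating \<open>j\<close>-linear form is a function on lists of vectors, extended by \<open>0\<close> to lists of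
  length other than \<open>j\<close>.  Degrees are integers: in degree \<open>-1\<close> the only such form is \<open>0\<close>, and the
  same holds above the dimension because the forms are alternating.\<close>

definition alt_form :: "int \<Rightarrow> ('a::euclidean_space list \<Rightarrow> real) \<Rightarrow> bool" where
  "alt_form j a \<longleftrightarrow>
     (\<forall>vs. int (length vs) \<noteq> j \<longrightarrow> a vs = 0) \<and>
     (\<forall>us ws. linear (\<lambda>v. a (us @ v # ws))) \<and>
     (\<forall>vs. \<not> distinct vs \<longrightarrow> a vs = 0)"

text \<open>The sum runs over all lists of \<open>j\<close> basis vectors, so each increasing multi-index occurs
  \<open>j!\<close> times up to a sign that cancels; hence the factor \<open>1 / j!\<close>.\<close>

definition alt_inner :: "int \<Rightarrow> ('a::euclidean_space list \<Rightarrow> real) \<Rightarrow> ('a list \<Rightarrow> real) \<Rightarrow> real" where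
  "alt_inner j a b =
     (\<Sum>vs | set vs \<subseteq> Basis \<and> int (length vs) = j. a vs * b vs) / fact (nat j)"

text \<open>Elements of \<open>L\<^sup>2\<close> are given by representatives: only the values on \<open>\<Omega>\<close> matter, and
  those up to null sets.\<close>

type_synonym 'a form = "'a \<Rightarrow> 'a list \<Rightarrow> real"

definition L2_forms :: "'a::euclidean_space set \<Rightarrow> int \<Rightarrow> 'a form set" where
  "L2_forms \<Omega> j =
     {\<omega>. (\<forall>x\<in>\<Omega>. alt_form j (\<omega> x)) \<and>
         (\<forall>vs. (\<lambda>x. \<omega> x vs) \<in> borel_measurable (lebesgue_on \<Omega>) \<and>
               integrable (lebesgue_on \<Omega>) (\<lambda>x. (\<omega> x vs)\<^sup>2))}"

definition form_inner :: "'a::euclidean_space set \<Rightarrow> int \<Rightarrow> 'a form \<Rightarrow> 'a form \<Rightarrow> real" where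
  "form_inner \<Omega> j \<omega> \<eta> = (LINT x|lebesgue_on \<Omega>. alt_inner j (\<omega> x) (\<eta> x))"

definition form_norm :: "'a::euclidean_space set \<Rightarrow> int \<Rightarrow> 'a form \<Rightarrow> real" where
  "form_norm \<Omega> j \<omega> = sqrt (form_inner \<Omega> j \<omega> \<omega>)"

text \<open>For smooth forms, \<open>(d\<omega>)(v\<^sub>0,\<dots>,v\<^sub>j)\<close> is the alternating sum of the derivatives of
  \<open>\<omega>(v\<^sub>0,\<dots>,v\<^sub>j)\<close> with \<open>v\<^sub>i\<close> omitted, in direction \<open>v\<^sub>i\<close>.  Moving the derivatives to
  \<open>\<psi>\<close> leaves the following boundary term.  With \<open>\<eta> = d\<omega>\<close> it equals, by Stokes' theorem, the
  integral over the boundary of \<open>\<psi>\<close> times \<open>(\<nu> \<and> \<omega>)(v\<^sub>0,\<dots>,v\<^sub>j)\<close> (\<open>\<nu>\<close> the outward unit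
  conormal), which involves only the trace (pullback to the boundary) of \<open>\<omega>\<close>.\<close>

definition boundary_pairing ::
  "'a::euclidean_space set \<Rightarrow> 'a form \<Rightarrow> 'a form \<Rightarrow> 'a list \<Rightarrow> ('a \<Rightarrow> real) \<Rightarrow> real" where
  "boundary_pairing \<Omega> \<omega> \<eta> vs \<psi> =
     (LINT x|lebesgue_on \<Omega>. \<eta> x vs * \<psi> x) +
     (\<Sum>i<length vs. (-1) ^ i *
        (LINT x|lebesgue_on \<Omega>.
           \<omega> x (take i vs @ drop (Suc i) vs) * frechet_derivative \<psi> (at x) (vs ! i)))"

text \<open>\<open>\<eta>\<close> is the exterior derivative of \<open>\<omega>\<close> in the sense of distributions on \<open>\<Omega>\<close>.\<close>

definition weak_ext_deriv :: "'a::euclidean_space set \<Rightarrow> 'a form \<Rightarrow> 'a form \<Rightarrow> bool" where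
  "weak_ext_deriv \<Omega> \<omega> \<eta> \<longleftrightarrow>
     (\<forall>vs \<psi>. test_fun \<Omega> \<psi> \<longrightarrow> boundary_pairing \<Omega> \<omega> \<eta> vs \<psi> = 0)"

definition H_forms :: "'a::euclidean_space set \<Rightarrow> int \<Rightarrow> 'a form set" where
  "H_forms \<Omega> j = {\<omega>\<in>L2_forms \<Omega> j. \<exists>\<eta>\<in>L2_forms \<Omega> (j + 1). weak_ext_deriv \<Omega> \<omega> \<eta>}"

definition ext_deriv :: "'a::euclidean_space set \<Rightarrow> int \<Rightarrow> 'a form \<Rightarrow> 'a form" where
  "ext_deriv \<Omega> j \<omega> = (SOME \<eta>. \<eta> \<in> L2_forms \<Omega> (j + 1) \<and> weak_ext_deriv \<Omega> \<omega> \<eta>)"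

text \<open>The trace of a form in \<open>H\<Lambda>\<^sup>j\<close> is a distribution on the boundary, defined by integration by
  parts against functions that are smooth up to the boundary.\<close>

definition trace_zero :: "'a::euclidean_space set \<Rightarrow> int \<Rightarrow> 'a form \<Rightarrow> bool" where
  "trace_zero \<Omega> j \<omega> \<longleftrightarrow>
     (\<forall>vs \<psi>. smooth_fun \<psi> \<longrightarrow> boundary_pairing \<Omega> \<omega> (ext_deriv \<Omega> j \<omega>) vs \<psi> = 0)"

definition H0_forms :: "'a::euclidean_space set \<Rightarrow> int \<Rightarrow> 'a form set" where
  "H0_forms \<Omega> j = {\<omega>\<in>H_forms \<Omega> j. trace_zero \<Omega> j \<omega>}"


section \<open>Finite element spaces\<close>

definition triangulation_of :: "'a::euclidean_space set set \<Rightarrow> 'a set \<Rightarrow> bool" where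
  "triangulation_of \<T> \<Omega> \<longleftrightarrow>
     triangulation \<T> \<and> (\<forall>K\<in>\<T>. int DIM('a) simplex K) \<and> \<Union>\<T> = closure \<Omega>"

definition shape_regular :: "real \<Rightarrow> 'a::euclidean_space set set \<Rightarrow> bool" where
  "shape_regular \<gamma> \<T> \<longleftrightarrow>
     (\<forall>K\<in>\<T>. \<exists>c. \<exists>r>0. cball c r \<subseteq> K \<and> diameter K \<le> \<gamma> * r)"

text \<open>Polynomial functions all of whose monomials have total degree in \<open>D\<close>.\<close>

definition polys_of_degrees :: "int set \<Rightarrow> ('a::euclidean_space \<Rightarrow> real) set" where
  "polys_of_degrees D =
     {p. \<exists>c. p = (\<lambda>x. \<Sum>\<alpha> | (\<forall>b. b \<notin> Basis \<longrightarrow> \<alpha> b = 0) \<and> int (\<Sum>b\<in>Basis. \<alpha> b) \<in> D.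
                     c \<alpha> * (\<Prod>b\<in>Basis. (x \<bullet> b) ^ (\<alpha> b :: nat)))}"

definition poly_forms_of_degrees :: "int set \<Rightarrow> int \<Rightarrow> 'a::euclidean_space form set" where
  "poly_forms_of_degrees D j =
     {p. (\<forall>x. alt_form j (p x)) \<and> (\<forall>vs. (\<lambda>x. p x vs) \<in> polys_of_degrees D)}"

text \<open>For negative \<open>s\<close> the following spaces are \<open>{0}\<close>.\<close>

definition poly_forms :: "int \<Rightarrow> int \<Rightarrow> 'a::euclidean_space form set" where
  "poly_forms s j = poly_forms_of_degrees {..s} j"

definition hom_poly_forms :: "int \<Rightarrow> int \<Rightarrow> 'a::euclidean_space form set" where
  "hom_poly_forms s j = poly_forms_of_degrees {s} j"

definition koszul :: "'a form \<Rightarrow> 'a form" where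
  "koszul \<omega> = (\<lambda>x vs. \<omega> x (x # vs))"

definition trimmed_poly_forms :: "int \<Rightarrow> int \<Rightarrow> 'a::euclidean_space form set" where
  "trimmed_poly_forms s j =
     {\<lambda>x vs. p x vs + koszul q x vs | p q.
        p \<in> poly_forms (s - 1) j \<and> q \<in> hom_poly_forms (s - 1) (j + 1)}"

text \<open>\<open>Full r\<close> uses polynomials of degree \<open>r - j\<close> in form degree \<open>j\<close>; \<open>Trimmed s\<close> uses the
  same \<open>s\<close> in every form degree.\<close>

datatype fe_family = Full int | Trimmed int

primrec shape_forms :: "fe_family \<Rightarrow> int \<Rightarrow> 'a::euclidean_space form set" where
  "shape_forms (Full r) j = poly_forms (r - j) j"
| "shape_forms (Trimmed s) j = trimmed_poly_forms s j"

definition fe_space ::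
  "'a::euclidean_space set \<Rightarrow> 'a set set \<Rightarrow> fe_family \<Rightarrow> int \<Rightarrow> 'a form set" where
  "fe_space \<Omega> \<T> fam j =
     {\<omega>\<in>H0_forms \<Omega> j.
        \<forall>K\<in>\<T>. \<exists>p\<in>shape_forms fam j. AE x in lebesgue_on \<Omega>. x \<in> K \<longrightarrow> \<omega> x = p x}"

text \<open>The discrete coderivative from degree \<open>j\<close> to degree \<open>j - 1\<close>.\<close>

definition discrete_coderiv ::
  "'a::euclidean_space set \<Rightarrow> 'a set set \<Rightarrow> fe_family \<Rightarrow> int \<Rightarrow> 'a form \<Rightarrow> 'a form" where
  "discrete_coderiv \<Omega> \<T> fam j \<omega> =
     (SOME \<tau>. \<tau> \<in> fe_space \<Omega> \<T> fam (j - 1) \<and>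
        (\<forall>v\<in>fe_space \<Omega> \<T> fam (j - 1).
           form_inner \<Omega> (j - 1) \<tau> v = form_inner \<Omega> j \<omega> (ext_deriv \<Omega> (j - 1) v)))"


section \<open>The mixed system\<close>

type_synonym 'a form3 = "'a form \<times> 'a form \<times> 'a form"

definition inner3 :: "'a::euclidean_space set \<Rightarrow> int \<Rightarrow> 'a form3 \<Rightarrow> 'a form3 \<Rightarrow> real" where
  "inner3 \<Omega> k = (\<lambda>(\<sigma>, \<mu>, \<omega>) (\<sigma>', \<mu>', \<omega>').
     form_inner \<Omega> (k - 1) \<sigma> \<sigma>' + form_inner \<Omega> k \<mu> \<mu>' + form_inner \<Omega> (k + 1) \<omega> \<omega>')"

definition norm3 :: "'a::euclidean_space set \<Rightarrow> int \<Rightarrow> 'a form3 \<Rightarrow> real" where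
  "norm3 \<Omega> k X = sqrt (inner3 \<Omega> k X X)"

definition fe_space3 ::
  "'a::euclidean_space set \<Rightarrow> 'a set set \<Rightarrow> fe_family \<Rightarrow> int \<Rightarrow> 'a form3 set" where
  "fe_space3 \<Omega> \<T> fam k =
     fe_space \<Omega> \<T> fam (k - 1) \<times> fe_space \<Omega> \<T> fam k \<times> fe_space \<Omega> \<T> fam (k + 1)"

definition A_h ::
  "'a::euclidean_space set \<Rightarrow> 'a set set \<Rightarrow> fe_family \<Rightarrow> int \<Rightarrow> 'a form3 \<Rightarrow> 'a form3" where
  "A_h \<Omega> \<T> fam k = (\<lambda>(\<sigma>, \<mu>, \<omega>).
     (\<lambda>x vs. - discrete_coderiv \<Omega> \<T> fam k \<mu> x vs,
      \<lambda>x vs. ext_deriv \<Omega> (k - 1) \<sigma> x vs + discrete_coderiv \<Omega> \<T> fam (k + 1) \<omega> x vs,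
      \<lambda>x vs. - ext_deriv \<Omega> k \<mu> x vs))"

definition source3 :: "(real \<Rightarrow> 'a form) \<Rightarrow> real \<Rightarrow> 'a form3" where
  "source3 f t = (\<lambda>x vs. 0, f t, \<lambda>x vs. 0)"

text \<open>Strong (Bochner) measurability in time with values in \<open>L\<^sup>2\<close>, and essential boundedness.\<close>

definition Linfty_L2 ::
  "real \<Rightarrow> 'a::euclidean_space set \<Rightarrow> int \<Rightarrow> (real \<Rightarrow> 'a form) set" where
  "Linfty_L2 T \<Omega> j =
     {f. (AE t in lebesgue_on {0<..<T}. f t \<in> L2_forms \<Omega> j) \<and>
         (\<exists>s::nat \<Rightarrow> real \<Rightarrow> 'a form.
            (\<forall>m. simple_function (lebesgue_on {0<..<T}) (s m) \<and>
                 s m ` {0<..<T} \<subseteq> L2_forms \<Omega> j) \<and>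
            (AE t in lebesgue_on {0<..<T}.
               (\<lambda>m. form_norm \<Omega> j (\<lambda>x vs. s m t x vs - f t x vs)) \<longlonglongrightarrow> 0)) \<and>
         (\<exists>C. AE t in lebesgue_on {0<..<T}. form_norm \<Omega> j (f t) \<le> C)}"


section \<open>Time discretization\<close>

definition time_node :: "real \<Rightarrow> nat \<Rightarrow> nat \<Rightarrow> real" where
  "time_node T N i = real i * (T / real N)"

text \<open>The affine representation holds on closed intervals, so neighbouring pieces agree at
  the common node; this is the continuity in time.\<close>

definition pw_linear :: "real \<Rightarrow> nat \<Rightarrow> (real \<Rightarrow> 'a form) \<Rightarrow> bool" where
  "pw_linear T N u \<longleftrightarrow>
     (\<forall>i\<in>{1..N}. \<exists>a b. \<forall>t\<in>{time_node T N (i - 1)..time_node T N i}.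
        u t = (\<lambda>x vs. a x vs + t * b x vs))"

definition P1_time :: "real \<Rightarrow> nat \<Rightarrow> 'a form3 set \<Rightarrow> (real \<Rightarrow> 'a form3) set" where
  "P1_time T N W =
     {U. (\<forall>t\<in>{0..T}. U t \<in> W) \<and> pw_linear T N (\<lambda>t. fst (U t)) \<and>
         pw_linear T N (\<lambda>t. fst (snd (U t))) \<and> pw_linear T N (\<lambda>t. snd (snd (U t)))}"

definition P0_time :: "real \<Rightarrow> nat \<Rightarrow> 'a form3 set \<Rightarrow> (real \<Rightarrow> 'a form3) set" where
  "P0_time T N W =
     {V. (\<forall>t\<in>{0..T}. V t \<in> W) \<and>
         (\<forall>i\<in>{1..N}. \<exists>c. \<forall>t\<in>{time_node T N (i - 1)<..<time_node T N i}. V t = c)}"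

definition form_time_deriv :: "(real \<Rightarrow> 'a form) \<Rightarrow> real \<Rightarrow> 'a form" where
  "form_time_deriv u t = (\<lambda>x vs. deriv (\<lambda>\<tau>. u \<tau> x vs) t)"

definition time_deriv3 :: "(real \<Rightarrow> 'a form3) \<Rightarrow> real \<Rightarrow> 'a form3" where
  "time_deriv3 U t =
     (form_time_deriv (\<lambda>\<tau>. fst (U \<tau>)) t,
      form_time_deriv (\<lambda>\<tau>. fst (snd (U \<tau>))) t,
      form_time_deriv (\<lambda>\<tau>. snd (snd (U \<tau>))) t)"

definition fully_discrete_solution ::
  "real \<Rightarrow> nat \<Rightarrow> 'a::euclidean_space set \<Rightarrow> 'a set set \<Rightarrow> fe_family \<Rightarrow> int \<Rightarrow>
   (real \<Rightarrow> 'a form3) \<Rightarrow> 'a form3 \<Rightarrow> (real \<Rightarrow> 'a form3) \<Rightarrow> bool" where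
  "fully_discrete_solution T N \<Omega> \<T> fam k F U0 U \<longleftrightarrow>
     U \<in> P1_time T N (fe_space3 \<Omega> \<T> fam k) \<and> U 0 = U0 \<and>
     (\<forall>V\<in>P0_time T N (fe_space3 \<Omega> \<T> fam k).
        (LINT t:{0..T}|lebesgue.
           inner3 \<Omega> k (time_deriv3 U t) (V t) + inner3 \<Omega> k (A_h \<Omega> \<T> fam k (U t)) (V t)) =
        (LINT t:{0..T}|lebesgue. inner3 \<Omega> k (F t) (V t)))"

end

theory Submission
  imports Defs
begin

text \<open>On a time interval the solution is affine, so testing with its midpoint value turns the time
  derivative into half the increment of \<open>\<parallel>U\<parallel>\<^sup>2\<close>, and the term with \<open>A_h\<close> vanishes because \<open>A_h\<close> is
  skew.  By Cauchy-Schwarz the increment of \<open>\<parallel>U\<parallel>\<^sup>2\<close> is at most \<open>\<parallel>U\<^sub>i\<parallel> + \<parallel>U\<^sub>i\<^sub>-\<^sub>1\<parallel>\<close> times the integral of \<open>\<parallel>f\<parallel>\<close>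
  over the interval; dividing and summing gives the estimate, even without the factor \<open>2\<close>.

  Skewness and linearity of \<open>A_h\<close> need two facts about the underlying spaces.  Weak exterior
  derivatives are unique up to null sets (fundamental lemma of the calculus of variations), hence
  \<open>ext_deriv\<close>, a choice of representative, is linear up to null sets.  The discrete coderivative
  exists by the Riesz representation theorem on the finite element space, which is finite-dimensional
  modulo null forms: an element is null as soon as its moments against finitely many polynomials
  on each simplex vanish.\<close>

section \<open>Smooth bump functions and the fundamental lemma of the calculus of variations\<close>

text \<open>Forms are representatives, so \<open>form_inner\<close> is only positive semidefinite,
  and \<open>ext_deriv\<close> and \<open>discrete_coderiv\<close> are values of
  \<open>SOME\<close>. Identities such as the linearity of \<open>A_h\<close> may fail pointwise, so
  they are asserted after pairing with a finite element function, where null sets no longer show.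
  Skewness alone does not remove the term with \<open>A_h\<close>: the test function is frozen at
  the midpoint value while the solution moves. Linearity makes the pairing affine in time and
  skewness makes it vanish at the midpoint; hence it is odd about the midpoint and integrates to
  zero. The factor 2 arises if the energy balance is summed first and every norm is then replaced by
  the largest one. Cancelling the sum of the two end norms on each interval separately avoids it.
  The resulting bound on the increment of the norm is two-sided, which is where conservation comes
  from when the source vanishes.\<close>

lemma Ck_fun_SucI:
  assumes "\<And>x. (f has_derivative f' x) (at x)" "\<And>v. Ck_fun m (\<lambda>x. f' x v)"
  shows "Ck_fun (Suc m) f"
proof -
  have "frechet_derivative f (at x) = f' x" for x
    using frechet_derivative_at[OF assms(1)] by simp
  then show ?thesis
    using assms by (auto simp: differentiable_def)
qed

lemma Ck_fun_SucD: "Ck_fun (Suc m) f \<Longrightarrow> Ck_fun m f"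
  by (induction m arbitrary: f)
     (auto intro!: differentiable_imp_continuous_on simp: differentiable_on_def differentiable_at_withinI)

lemma Ck_fun_has_derivative:
  "Ck_fun (Suc m) f \<Longrightarrow> (f has_derivative frechet_derivative f (at x)) (at x)"
  by (simp add: frechet_derivative_works)

lemma Ck_fun_const: "Ck_fun m (\<lambda>x. c)"
proof (induction m arbitrary: c)
  case (Suc m)
  show ?case
    by (rule Ck_fun_SucI[where f' = "\<lambda>x v. 0"]) (use Suc in auto)
qed simp

lemma Ck_fun_add: "Ck_fun m f \<Longrightarrow> Ck_fun m g \<Longrightarrow> Ck_fun m (\<lambda>x. f x + g x)"
proof (induction m arbitrary: f g)
  case (Suc m)
  show ?case
    by (rule Ck_fun_SucI[OF has_derivative_add[OF Suc.prems[THEN Ck_fun_has_derivative]]])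
       (use Suc in auto)
qed (auto intro: continuous_intros)

lemma Ck_fun_mult: "Ck_fun m f \<Longrightarrow> Ck_fun m g \<Longrightarrow> Ck_fun m (\<lambda>x. f x * g x)"
proof (induction m arbitrary: f g)
  case (Suc m)
  show ?case
    by (rule Ck_fun_SucI[OF has_derivative_mult[OF Suc.prems[THEN Ck_fun_has_derivative]]])
       (use Suc Ck_fun_SucD[OF Suc.prems(1)] Ck_fun_SucD[OF Suc.prems(2)] in
         \<open>auto intro!: Ck_fun_add Suc.IH\<close>)
qed (auto intro: continuous_intros)

lemma Ck_fun_prod: "(\<And>i. i \<in> I \<Longrightarrow> Ck_fun m (f i)) \<Longrightarrow> Ck_fun m (\<lambda>x. \<Prod>i\<in>I. f i x)"
  by (induction I rule: infinite_finite_induct) (auto intro: Ck_fun_const Ck_fun_mult)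

text \<open>The family \<open>flat p\<close> is closed under differentiation, so smoothness follows by induction for all
  \<open>p\<close> at once.\<close>

definition flat :: "real poly \<Rightarrow> real \<Rightarrow> real" where
  "flat p t = (if t > 0 then poly p (1 / t) * exp (- (1 / t)) else 0)"

lemma tendsto_poly_over_exp: "((\<lambda>x::real. poly p x * exp (- x)) \<longlongrightarrow> 0) at_top"
proof -
  have "((\<lambda>x. \<Sum>i\<le>degree p. coeff p i * (x ^ i / exp x)) \<longlongrightarrow> (\<Sum>i\<le>degree p. coeff p i * 0)) at_top"
    by (intro tendsto_intros tendsto_power_div_exp_0)
  then show ?thesis
    by (simp add: poly_altdef sum_distrib_right exp_minus divide_inverse mult.assoc)
qed

text \<open>With p read as a polynomial in 1/t, differentiation turns p into X^2 (p - p'): the chain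
  rule gives the factor 1/t^2, the exponential contributes p and the polynomial contributes -p'. At
  0 the exponential beats every power of 1/t.\<close>

lemma has_real_derivative_flat:
  "(flat p has_real_derivative flat ([:0, 0, 1:] * (p - pderiv p)) t) (at t)"
proof -
  consider "t > 0" | "t < 0" | "t = 0" by linarith
  then show ?thesis
  proof cases
    case 1
    have "((\<lambda>s. poly p (1 / s) * exp (- (1 / s))) has_real_derivative
        flat ([:0, 0, 1:] * (p - pderiv p)) t) (at t)"
      using 1
      by (auto intro!: derivative_eq_intros DERIV_chain2[OF poly_DERIV]
          simp: flat_def field_simps power2_eq_square)
    then show ?thesis
      by (rule has_field_derivative_transform_within_open[where S = "{0<..}"])
         (use 1 in \<open>auto simp: flat_def\<close>)
  next
    case 2
    have "((\<lambda>s. 0) has_real_derivative flat ([:0, 0, 1:] * (p - pderiv p)) t) (at t)"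
      using 2 by (auto simp: flat_def)
    then show ?thesis
      by (rule has_field_derivative_transform_within_open[where S = "{..<0}"])
         (use 2 in \<open>auto simp: flat_def\<close>)
  next
    case 3
    \<comment> \<open>To the right of 0 the difference quotient has the same shape as
      \<open>flat\<close> itself, the division by h turning p into X p.\<close>
    have "((\<lambda>h. poly ([:0, 1:] * p) (1 / h) * exp (- (1 / h))) \<longlongrightarrow> 0) (at_right 0)"
      using filterlim_compose[OF tendsto_poly_over_exp[of "[:0, 1:] * p"] filterlim_inverse_at_top_right]
      by (simp add: inverse_eq_divide)
    then have "((\<lambda>h. (flat p (t + h) - flat p t) / h) \<longlongrightarrow> 0) (at_right 0)"
      by (rule Lim_transform_eventually)
         (auto simp: eventually_at_filter 3 flat_def)
    moreover have "((\<lambda>h. (flat p (t + h) - flat p t) / h) \<longlongrightarrow> 0) (at_left 0)"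
      by (rule Lim_transform_eventually[OF tendsto_const])
         (auto simp: eventually_at_filter 3 flat_def)
    ultimately have "((\<lambda>h. (flat p (t + h) - flat p t) / h) \<longlongrightarrow> 0) (at 0)"
      by (simp add: filterlim_split_at)
    then show ?thesis
      by (simp add: DERIV_def 3 flat_def)
  qed
qed

lemma Ck_fun_flat_affine:
  "Ck_fun m (\<lambda>x::'a::euclidean_space. flat p (r * (x \<bullet> i) + s))"
proof (induction m arbitrary: p)
  case 0
  have "continuous_on UNIV (flat p)"
    by (meson DERIV_continuous_on has_real_derivative_flat has_field_derivative_at_within)
  then show ?case
    by (auto intro!: continuous_on_compose2[where f = "\<lambda>x. r * (x \<bullet> i) + s"] continuous_intros)
next
  case (Suc m)
  let ?q = "[:0, 0, 1:] * (p - pderiv p)"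
  show ?case
  proof (rule Ck_fun_SucI)
    show "((\<lambda>x. flat p (r * (x \<bullet> i) + s)) has_derivative
        (\<lambda>v. (flat ?q (r * (x \<bullet> i) + s)) * (r * (v \<bullet> i)))) (at x)" for x :: 'a
      by (rule has_derivative_compose[where g = "flat p" and f = "\<lambda>x. r * (x \<bullet> i) + s",
            OF _ has_real_derivative_flat[unfolded has_field_derivative_def]])
         (auto intro!: derivative_eq_intros)
  qed (intro Ck_fun_mult Ck_fun_const Suc.IH)
qed

text \<open>For t > 0, \<open>flat 1 t\<close> is exp (-1/t), which tends to 1 as t grows. Scaling
  by r therefore lets the product converge to the indicator of the open box while its support stays
  in the closed box. The arguments are spelled in the form \<open>r * (x \<bullet> i) + s\<close>
  that the smoothness lemma expects.\<close>

definition box_bump :: "'a::euclidean_space \<Rightarrow> 'a \<Rightarrow> real \<Rightarrow> 'a \<Rightarrow> real" where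
  "box_bump a b r x =
     (\<Prod>i\<in>Basis. flat 1 (r * (x \<bullet> i) + - (r * (a \<bullet> i))) * flat 1 (- r * (x \<bullet> i) + r * (b \<bullet> i)))"

lemma smooth_fun_box_bump: "smooth_fun (box_bump a b r)"
  unfolding smooth_fun_def box_bump_def
  by (intro allI Ck_fun_prod Ck_fun_mult Ck_fun_flat_affine)

lemma flat_one_bounds: "0 \<le> flat 1 t" "flat 1 t \<le> 1"
  by (auto simp: flat_def)

lemma box_bump_bounds: "\<bar>box_bump a b r x\<bar> \<le> 1"
  unfolding box_bump_def abs_prod
  by (intro prod_le_1) (auto simp: abs_mult flat_one_bounds intro!: mult_le_one)

lemma box_bump_eq_0:
  assumes "x \<notin> box a b" "r > 0"
  shows "box_bump a b r x = 0"
proof -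
  obtain i where i: "i \<in> Basis" "x \<bullet> i \<le> a \<bullet> i \<or> b \<bullet> i \<le> x \<bullet> i"
    using assms by (auto simp: mem_box not_less)
  then have "flat 1 (r * (x \<bullet> i) + - (r * (a \<bullet> i))) * flat 1 (- r * (x \<bullet> i) + r * (b \<bullet> i)) = 0"
    using \<open>r > 0\<close> by (auto simp: flat_def)
  then show ?thesis
    using i(1) by (auto simp: box_bump_def prod_zero_iff)
qed

lemma test_fun_box_bump:
  assumes "cbox a b \<subseteq> \<Omega>" "r > 0"
  shows "test_fun \<Omega> (box_bump a b r)"
proof -
  have "{x. box_bump a b r x \<noteq> 0} \<subseteq> cbox a b"
    using box_bump_eq_0[of _ a b r] assms(2) box_subset_cbox by blast
  then have "closure {x. box_bump a b r x \<noteq> 0} \<subseteq> cbox a b"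
    by (rule closure_minimal) (rule closed_cbox)
  moreover from this have "compact (closure {x. box_bump a b r x \<noteq> 0})"
    by (meson bounded_cbox bounded_subset closed_closure compact_eq_bounded_closed)
  ultimately show ?thesis
    using assms smooth_fun_box_bump by (auto simp: test_fun_def)
qed

lemma flat_one_tendsto:
  assumes "t > 0"
  shows "(\<lambda>m. flat 1 (real (Suc m) * t)) \<longlonglongrightarrow> 1"
proof -
  have "(\<lambda>m. exp (- (inverse (real (Suc m)) * (1 / t)))) \<longlonglongrightarrow> exp (- (0 * (1 / t)))"
    by (intro tendsto_intros LIMSEQ_inverse_real_of_nat)
  then show ?thesis
    using assms by (simp add: flat_def field_simps del: of_nat_Suc)
qed

lemma box_bump_tendsto:
  fixes a b x :: "'a::euclidean_space"
  shows "(\<lambda>m. box_bump a b (real (Suc m)) x) \<longlonglongrightarrow> indicator (box a b) x"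
proof (cases "x \<in> box a b")
  case True
  have "(\<lambda>m. \<Prod>i\<in>Basis. flat 1 (real (Suc m) * (x \<bullet> i - a \<bullet> i)) * flat 1 (real (Suc m) * (b \<bullet> i - x \<bullet> i)))
      \<longlonglongrightarrow> (\<Prod>i\<in>(Basis::'a set). 1 * 1)"
    by (intro tendsto_prod tendsto_mult flat_one_tendsto) (use True in \<open>auto simp: mem_box\<close>)
  then show ?thesis
    using True by (simp add: box_bump_def algebra_simps del: of_nat_Suc)
qed (simp add: box_bump_eq_0)

lemma borel_measurable_box_bump: "box_bump a b r \<in> borel_measurable (lebesgue_on S)"
proof -
  have "continuous_on UNIV (box_bump a b r)"
    using smooth_fun_box_bump[of a b r] unfolding smooth_fun_def by (metis Ck_fun.simps(1))
  then have "box_bump a b r \<in> borel_measurable lborel"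
    by (simp add: borel_measurable_continuous_onI)
  then show ?thesis
    by (intro measurable_restrict_space1 measurable_completion)
qed

section \<open>Functions orthogonal to all test functions vanish almost everywhere\<close>

lemma integrable_lebesgue_on_subset:
  fixes g :: "'a::euclidean_space \<Rightarrow> real"
  assumes "integrable (lebesgue_on S) g" "S \<in> sets lebesgue" "A \<in> sets lebesgue" "A \<subseteq> S"
  shows "integrable (lebesgue_on A) g"
proof -
  have "integrable lebesgue (\<lambda>x. indicator A x *\<^sub>R (if x \<in> S then g x else 0))"
    using assms by (intro integrable_mult_indicator) (auto simp: Lebesgue_Measure.integrable_restrict_UNIV)
  also have "(\<lambda>x. indicator A x *\<^sub>R (if x \<in> S then g x else 0)) = (\<lambda>x. if x \<in> A then g x else 0)"
    using assms(4) by (auto simp: indicator_def fun_eq_iff)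
  finally show ?thesis
    using assms(3) by (simp add: Lebesgue_Measure.integrable_restrict_UNIV)
qed

text \<open>The bumps are bounded by 1 and converge to the indicator of the open box, so dominated
  convergence applies with the absolute value of g as majorant. The conclusion is phrased with the
  gauge integral of the extension by zero because the differentiation theorem for averages over
  cubes is phrased that way.\<close>

lemma integral_box_eq_0_if_test_fun_orthogonal:
  fixes g :: "'a::euclidean_space \<Rightarrow> real"
  assumes \<Omega>: "\<Omega> \<in> sets lebesgue" and g: "integrable (lebesgue_on \<Omega>) g"
    and orth: "\<And>\<psi>. test_fun \<Omega> \<psi> \<Longrightarrow> (LINT x|lebesgue_on \<Omega>. g x * \<psi> x) = 0"
    and ab: "cbox a b \<subseteq> \<Omega>"
  shows "integral (cbox a b) (\<lambda>x. if x \<in> \<Omega> then g x else 0) = 0"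
proof -
  have "(\<lambda>m. LINT x|lebesgue_on \<Omega>. g x * box_bump a b (real (Suc m)) x)
      \<longlonglongrightarrow> (LINT x|lebesgue_on \<Omega>. g x * indicator (box a b) x)"
  proof (rule integral_dominated_convergence[where w = "\<lambda>x. \<bar>g x\<bar>"])
    show "(\<lambda>x. g x * box_bump a b (real (Suc m)) x) \<in> borel_measurable (lebesgue_on \<Omega>)" for m
      by (intro borel_measurable_times borel_measurable_integrable[OF g] borel_measurable_box_bump)
    show "AE x in lebesgue_on \<Omega>. (\<lambda>m. g x * box_bump a b (real (Suc m)) x)
        \<longlonglongrightarrow> g x * indicator (box a b) x"
      by (intro AE_I2 tendsto_intros box_bump_tendsto)
    show "AE x in lebesgue_on \<Omega>. norm (g x * box_bump a b (real (Suc m)) x) \<le> \<bar>g x\<bar>" for m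
      using box_bump_bounds[of a b "real (Suc m)"]
      by (intro AE_I2) (auto simp: abs_mult intro!: mult_left_le simp del: of_nat_Suc)
    have "indicat_real (box a b) \<in> borel_measurable (lebesgue_on \<Omega>)"
      by (intro measurable_restrict_space1 borel_measurable_indicator) simp
    then show "(\<lambda>x. g x * indicator (box a b) x) \<in> borel_measurable (lebesgue_on \<Omega>)"
      by (intro borel_measurable_times borel_measurable_integrable[OF g])
  qed (use g in auto)
  then have "(LINT x|lebesgue_on \<Omega>. g x * indicator (box a b) x) = 0"
    using orth[OF test_fun_box_bump[OF ab]] by (simp add: LIMSEQ_const_iff)
  moreover have sub: "box a b \<subseteq> \<Omega>"
    using ab box_subset_cbox by blast
  then have "(\<lambda>x. indicator \<Omega> x *\<^sub>R (g x * indicator (box a b) x)) =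
      (\<lambda>x. indicator (box a b) x *\<^sub>R g x)"
    by (auto simp: indicator_def fun_eq_iff)
  then have "(LINT x|lebesgue_on \<Omega>. g x * indicator (box a b) x) = (LINT x|lebesgue_on (box a b). g x)"
    using \<Omega> by (simp add: integral_restrict_space)
  moreover have "integrable (lebesgue_on (box a b)) g"
    by (rule integrable_lebesgue_on_subset[OF g \<Omega> _ sub]) simp
  ultimately have "integral (box a b) g = 0"
    by (simp add: lebesgue_integral_eq_integral)
  moreover have "integral (cbox a b) (\<lambda>x. if x \<in> \<Omega> then g x else 0) = integral (cbox a b) g"
    by (rule integral_cong) (use ab in auto)
  ultimately show ?thesis
    by (simp add: integral_open_interval)
qed

text \<open>At almost every point g is the limit of its averages over small cubes with a corner
  there, and in an open set all these averages are zero.\<close>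

lemma test_fun_orthogonal_imp_AE_zero:
  fixes g :: "'a::euclidean_space \<Rightarrow> real"
  assumes \<Omega>: "open \<Omega>" and g: "integrable (lebesgue_on \<Omega>) g"
    and orth: "\<And>\<psi>. test_fun \<Omega> \<psi> \<Longrightarrow> (LINT x|lebesgue_on \<Omega>. g x * \<psi> x) = 0"
  shows "AE x in lebesgue_on \<Omega>. g x = 0"
proof -
  let ?g = "\<lambda>x. if x \<in> \<Omega> then g x else 0"
  have \<Omega>_sets: "\<Omega> \<in> sets lebesgue"
    using \<Omega> by auto
  have "?g integrable_on cbox a b" for a b
  proof -
    have "integrable lebesgue ?g"
      using g \<Omega>_sets by (simp add: Lebesgue_Measure.integrable_restrict_UNIV)
    then show ?thesis
      using integrable_on_lebesgue integrable_on_subcbox by blast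
  qed
  then obtain N where N: "negligible N"
    and lim: "\<And>x e. \<lbrakk>x \<notin> N; 0 < e\<rbrakk> \<Longrightarrow> \<exists>d>0. \<forall>h. 0 < h \<and> h < d \<longrightarrow>
        norm (integral (cbox x (x + h *\<^sub>R One)) ?g /\<^sub>R h ^ DIM('a) - ?g x) < e"
    using integrable_ccontinuous_explicit[of ?g] by blast
  have "g x = 0" if x: "x \<in> \<Omega>" "x \<notin> N" for x
  proof (rule ccontr)
    assume "g x \<noteq> 0"
    then obtain d where d: "d > 0" "\<And>h. 0 < h \<Longrightarrow> h < d \<Longrightarrow>
        norm (integral (cbox x (x + h *\<^sub>R One)) ?g /\<^sub>R h ^ DIM('a) - ?g x) < \<bar>g x\<bar>"
      using lim[OF x(2), of "\<bar>g x\<bar>"] by auto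
    obtain r where r: "r > 0" "cball x r \<subseteq> \<Omega>"
      using \<Omega> x(1) open_contains_cball by blast
    \<comment> \<open>Halving d gives h < d strictly. Dividing r by the dimension keeps the cube of
      side h inside the ball, since the norm is at most the sum of the absolute coordinates.\<close>
    define h where "h = min (d / 2) (r / DIM('a))"
    have h: "0 < h" "h < d" "h * DIM('a) \<le> r"
      using d(1) r(1) by (auto simp: h_def min_def field_simps)
    have "cbox x (x + h *\<^sub>R One) \<subseteq> cball x r"
    proof
      fix y assume y: "y \<in> cbox x (x + h *\<^sub>R One)"
      have "norm (y - x) \<le> (\<Sum>b\<in>Basis. \<bar>(y - x) \<bullet> b\<bar>)"
        by (rule norm_le_l1)
      also have "\<dots> \<le> (\<Sum>b\<in>(Basis::'a set). h)"
        using y by (intro sum_mono) (auto simp: mem_box inner_diff_left inner_add_left)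
      finally show "y \<in> cball x r"
        using h(3) by (simp add: dist_norm norm_minus_commute mult.commute)
    qed
    then have "integral (cbox x (x + h *\<^sub>R One)) ?g = 0"
      using r(2) by (intro integral_box_eq_0_if_test_fun_orthogonal[OF \<Omega>_sets g orth]) auto
    then show False
      using d(2)[OF h(1,2)] x(1) by simp
  qed
  moreover have "N \<in> null_sets lebesgue"
    using N negligible_iff_null_sets by blast
  ultimately have "AE x in lebesgue. x \<in> \<Omega> \<longrightarrow> g x = 0"
    by (intro AE_I'[of N]) auto
  then show ?thesis
    using \<Omega>_sets by (simp add: AE_restrict_space_iff)
qed

section \<open>Square integrable forms\<close>

text \<open>One operation carries all the linear algebra: sums, differences, negatives and the zero
  form are obtained by choosing the two coefficients.\<close>

definition lin_comb :: "real \<Rightarrow> 'a form \<Rightarrow> real \<Rightarrow> 'a form \<Rightarrow> 'a form" where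
  "lin_comb a \<omega> b \<eta> = (\<lambda>x vs. a * \<omega> x vs + b * \<eta> x vs)"

lemma integrable_mult_if_squares_integrable:
  fixes u v :: "'b \<Rightarrow> real"
  assumes [measurable]: "u \<in> borel_measurable M" "v \<in> borel_measurable M"
    and "integrable M (\<lambda>x. (u x)\<^sup>2)" "integrable M (\<lambda>x. (v x)\<^sup>2)"
  shows "integrable M (\<lambda>x. u x * v x)"
proof (rule Bochner_Integration.integrable_bound)
  show "integrable M (\<lambda>x. (u x)\<^sup>2 + (v x)\<^sup>2)"
    using assms by simp
  have "\<bar>u x * v x\<bar> \<le> (u x)\<^sup>2 + (v x)\<^sup>2" for x
  proof -
    have "2 * (\<bar>u x\<bar> * \<bar>v x\<bar>) \<le> \<bar>u x\<bar>\<^sup>2 + \<bar>v x\<bar>\<^sup>2"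
      using sum_squares_bound[of "\<bar>u x\<bar>" "\<bar>v x\<bar>"] by (simp add: mult.assoc)
    then show ?thesis
      by (simp add: abs_mult) (smt (verit) mult_nonneg_nonneg)
  qed
  then show "AE x in M. norm (u x * v x) \<le> norm ((u x)\<^sup>2 + (v x)\<^sup>2)"
    by (simp add: abs_of_nonneg)
qed measurable

lemma alt_form_lin_comb:
  assumes "alt_form j u" "alt_form j v"
  shows "alt_form j (\<lambda>vs. a * u vs + b * v vs)"
proof -
  have "linear (\<lambda>w. a * u (us @ w # ws) + b * v (us @ w # ws))" for us ws
  proof -
    have "linear (\<lambda>w. u (us @ w # ws))" "linear (\<lambda>w. v (us @ w # ws))"
      using assms by (auto simp: alt_form_def)
    then have "linear (\<lambda>w. a *\<^sub>R u (us @ w # ws) + b *\<^sub>R v (us @ w # ws))"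
      by (intro linear_compose_add linear_compose_scale_right)
    then show ?thesis
      by (simp only: real_scaleR_def)
  qed
  then show ?thesis
    using assms by (simp add: alt_form_def)
qed

lemma L2_forms_measurable:
  "\<omega> \<in> L2_forms \<Omega> j \<Longrightarrow> (\<lambda>x. \<omega> x vs) \<in> borel_measurable (lebesgue_on \<Omega>)"
  and L2_forms_square_integrable:
  "\<omega> \<in> L2_forms \<Omega> j \<Longrightarrow> integrable (lebesgue_on \<Omega>) (\<lambda>x. (\<omega> x vs)\<^sup>2)"
  and L2_forms_alt_form: "\<omega> \<in> L2_forms \<Omega> j \<Longrightarrow> x \<in> \<Omega> \<Longrightarrow> alt_form j (\<omega> x)"
  by (auto simp: L2_forms_def)

lemma L2_forms_lin_comb:
  assumes "\<omega> \<in> L2_forms \<Omega> j" "\<eta> \<in> L2_forms \<Omega> j"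
  shows "lin_comb a \<omega> b \<eta> \<in> L2_forms \<Omega> j"
proof -
  have "integrable (lebesgue_on \<Omega>) (\<lambda>x. (a * \<omega> x vs + b * \<eta> x vs)\<^sup>2)" for vs
  proof -
    note m = L2_forms_measurable[OF assms(1)] L2_forms_measurable[OF assms(2)]
      and s = L2_forms_square_integrable[OF assms(1)] L2_forms_square_integrable[OF assms(2)]
    have "integrable (lebesgue_on \<Omega>) (\<lambda>x. a\<^sup>2 * (\<omega> x vs)\<^sup>2 + b\<^sup>2 * (\<eta> x vs)\<^sup>2
        + 2 * a * b * (\<omega> x vs * \<eta> x vs))"
      using s integrable_mult_if_squares_integrable[OF m s] by simp
    then show ?thesis
      by (simp add: power2_sum power_mult_distrib algebra_simps)
  qed
  moreover have "(\<lambda>x. a * \<omega> x vs + b * \<eta> x vs) \<in> borel_measurable (lebesgue_on \<Omega>)" for vs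
    using L2_forms_measurable[OF assms(1)] L2_forms_measurable[OF assms(2)] by simp
  ultimately show ?thesis
    using assms unfolding L2_forms_def lin_comb_def by (simp add: alt_form_lin_comb)
qed

lemma zero_in_L2_forms: "(\<lambda>x vs. 0) \<in> L2_forms \<Omega> j"
  by (auto simp: L2_forms_def alt_form_def linear_zero)

lemma integrable_component_product:
  assumes "\<omega> \<in> L2_forms \<Omega> i" "\<eta> \<in> L2_forms \<Omega> j"
  shows "integrable (lebesgue_on \<Omega>) (\<lambda>x. \<omega> x vs * \<eta> x ws)"
  by (intro integrable_mult_if_squares_integrable L2_forms_measurable[OF assms(1)]
      L2_forms_measurable[OF assms(2)] L2_forms_square_integrable[OF assms(1)]
      L2_forms_square_integrable[OF assms(2)])

section \<open>Inner product and norm of square integrable forms\<close>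

lemma integrable_alt_inner:
  assumes "\<omega> \<in> L2_forms \<Omega> j" "\<eta> \<in> L2_forms \<Omega> j"
  shows "integrable (lebesgue_on \<Omega>) (\<lambda>x. alt_inner j (\<omega> x) (\<eta> x))"
  unfolding alt_inner_def
  by (intro integrable_divide_zero Bochner_Integration.integrable_sum integrable_component_product[OF assms])

lemma alt_inner_commute: "alt_inner j u v = alt_inner j v u"
  by (simp add: alt_inner_def mult.commute)

lemma alt_inner_lin_comb_left:
  "alt_inner j (\<lambda>vs. a * u vs + b * v vs) w = a * alt_inner j u w + b * alt_inner j v w"
  by (simp add: alt_inner_def sum.distrib sum_distrib_left add_divide_distrib algebra_simps)

lemma alt_inner_self_nonneg: "0 \<le> alt_inner j u u"
  by (auto simp: alt_inner_def intro!: divide_nonneg_nonneg sum_nonneg)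

lemma form_inner_commute: "form_inner \<Omega> j \<omega> \<eta> = form_inner \<Omega> j \<eta> \<omega>"
  by (simp add: form_inner_def alt_inner_commute)

lemma form_inner_self_nonneg: "0 \<le> form_inner \<Omega> j \<omega> \<omega>"
  by (simp add: form_inner_def alt_inner_self_nonneg)

lemma form_inner_lin_comb_left:
  assumes "\<omega> \<in> L2_forms \<Omega> j" "\<eta> \<in> L2_forms \<Omega> j" "\<theta> \<in> L2_forms \<Omega> j"
  shows "form_inner \<Omega> j (lin_comb a \<omega> b \<eta>) \<theta> = a * form_inner \<Omega> j \<omega> \<theta> + b * form_inner \<Omega> j \<eta> \<theta>"
  using assms by (simp add: form_inner_def lin_comb_def alt_inner_lin_comb_left integrable_alt_inner)

lemma form_inner_lin_comb_right:
  assumes "\<omega> \<in> L2_forms \<Omega> j" "\<eta> \<in> L2_forms \<Omega> j" "\<theta> \<in> L2_forms \<Omega> j"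
  shows "form_inner \<Omega> j \<theta> (lin_comb a \<omega> b \<eta>) = a * form_inner \<Omega> j \<theta> \<omega> + b * form_inner \<Omega> j \<theta> \<eta>"
  using form_inner_lin_comb_left[OF assms] by (simp add: form_inner_commute)

lemma form_inner_zero: "form_inner \<Omega> j (\<lambda>x vs. 0) \<eta> = 0" "form_inner \<Omega> j \<eta> (\<lambda>x vs. 0) = 0"
  by (simp_all add: form_inner_def alt_inner_def)

text \<open>A nonzero representative may have norm 0, so the argument uses only that the quadratic
  form of the pair is nonnegative, with the degenerate case C = 0 treated separately.\<close>

lemma form_inner_Cauchy_Schwarz:
  assumes "\<omega> \<in> L2_forms \<Omega> j" "\<eta> \<in> L2_forms \<Omega> j"
  shows "\<bar>form_inner \<Omega> j \<omega> \<eta>\<bar> \<le> form_norm \<Omega> j \<omega> * form_norm \<Omega> j \<eta>"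
proof -
  define A B C where ABC: "A = form_inner \<Omega> j \<omega> \<omega>" "B = form_inner \<Omega> j \<omega> \<eta>" "C = form_inner \<Omega> j \<eta> \<eta>"
  have quad: "0 \<le> a\<^sup>2 * A + 2 * a * b * B + b\<^sup>2 * C" for a b
    using form_inner_self_nonneg[of \<Omega> j "lin_comb a \<omega> b \<eta>"] assms
    by (simp add: form_inner_lin_comb_left form_inner_lin_comb_right L2_forms_lin_comb ABC
        form_inner_commute[of \<Omega> j \<eta> \<omega>] power2_eq_square algebra_simps)
  have "A \<ge> 0" "C \<ge> 0"
    by (simp_all add: ABC form_inner_self_nonneg)
  have "B\<^sup>2 \<le> A * C"
  proof (cases "C = 0")
    case True
    have "B = 0"
    proof (rule ccontr)
      assume "B \<noteq> 0"
      \<comment> \<open>For C = 0 the quadratic form at (1, b) is A + 2 b B; this choice of b brings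
        it to -1.\<close>
      then have "2 * 1 * (- (A + 1) / (2 * B)) * B = - (A + 1)"
        by simp
      then show False
        using quad[of 1 "- (A + 1) / (2 * B)"] True by simp
    qed
    then show ?thesis
      using \<open>A \<ge> 0\<close> \<open>C \<ge> 0\<close> by simp
  next
    case False
    have "0 \<le> C * (A * C - B\<^sup>2)"
      using quad[of C "- B"] by (simp add: power2_eq_square algebra_simps)
    then show ?thesis
      using False \<open>C \<ge> 0\<close> by (simp add: zero_le_mult_iff)
  qed
  then have "\<bar>B\<bar> \<le> sqrt (A * C)"
    using real_le_rsqrt[of "\<bar>B\<bar>"] by simp
  then show ?thesis
    by (simp add: ABC form_norm_def real_sqrt_mult)
qed

lemma form_norm_nonneg: "0 \<le> form_norm \<Omega> j \<omega>"
  by (simp add: form_norm_def form_inner_self_nonneg)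

lemma form_norm_square: "(form_norm \<Omega> j \<omega>)\<^sup>2 = form_inner \<Omega> j \<omega> \<omega>"
  by (simp add: form_norm_def form_inner_self_nonneg)

lemma form_norm_lin_comb_le:
  assumes "\<omega> \<in> L2_forms \<Omega> j" "\<eta> \<in> L2_forms \<Omega> j"
  shows "form_norm \<Omega> j (lin_comb a \<omega> b \<eta>) \<le> \<bar>a\<bar> * form_norm \<Omega> j \<omega> + \<bar>b\<bar> * form_norm \<Omega> j \<eta>"
proof (rule power2_le_imp_le)
  define x y z where "x = form_norm \<Omega> j \<omega>" "y = form_norm \<Omega> j \<eta>" "z = form_inner \<Omega> j \<omega> \<eta>"
  have "(form_norm \<Omega> j (lin_comb a \<omega> b \<eta>))\<^sup>2 = a * (a * x\<^sup>2 + b * z) + b * (a * z + b * y\<^sup>2)"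
    unfolding x_y_z_def form_norm_square
    by (simp add: form_inner_lin_comb_left form_inner_lin_comb_right L2_forms_lin_comb assms
        form_inner_commute[of \<Omega> j \<eta> \<omega>])
  also have "\<dots> = a\<^sup>2 * x\<^sup>2 + 2 * (a * b * z) + b\<^sup>2 * y\<^sup>2"
    by (simp add: power2_eq_square algebra_simps)
  also have "\<dots> \<le> a\<^sup>2 * x\<^sup>2 + 2 * (\<bar>a * b\<bar> * (x * y)) + b\<^sup>2 * y\<^sup>2"
  proof -
    have "a * b * z \<le> \<bar>a * b\<bar> * \<bar>z\<bar>"
      by (metis abs_ge_self abs_mult)
    also have "\<dots> \<le> \<bar>a * b\<bar> * (x * y)"
      unfolding x_y_z_def by (intro mult_left_mono form_inner_Cauchy_Schwarz assms) simp
    finally show ?thesis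
      by simp
  qed
  also have "\<dots> = (\<bar>a\<bar> * x + \<bar>b\<bar> * y)\<^sup>2"
    by (simp add: power2_sum power_mult_distrib abs_mult)
  finally show "(form_norm \<Omega> j (lin_comb a \<omega> b \<eta>))\<^sup>2
      \<le> (\<bar>a\<bar> * form_norm \<Omega> j \<omega> + \<bar>b\<bar> * form_norm \<Omega> j \<eta>)\<^sup>2"
    by (simp only: x_y_z_def)
qed (simp add: form_norm_nonneg)

lemma finite_basis_lists: "finite {vs :: 'a::euclidean_space list. set vs \<subseteq> Basis \<and> int (length vs) = j}"
proof (rule finite_subset)
  show "finite {vs :: 'a list. set vs \<subseteq> Basis \<and> length vs = nat j}"
    by (rule finite_lists_length_eq) simp
qed auto

text \<open>The exceptional null set in \<open>eq\<close> may depend on the list of vectors. Since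
  \<open>alt_inner\<close> evaluates only the finitely many lists of basis vectors, a single null
  set suffices.\<close>

lemma form_inner_cong_AE:
  assumes "\<omega> \<in> L2_forms \<Omega> j" "\<omega>' \<in> L2_forms \<Omega> j" "\<theta> \<in> L2_forms \<Omega> j"
    and eq: "\<And>vs. AE x in lebesgue_on \<Omega>. \<omega> x vs = \<omega>' x vs"
  shows "form_inner \<Omega> j \<omega> \<theta> = form_inner \<Omega> j \<omega>' \<theta>"
proof -
  let ?I = "{vs :: 'a list. set vs \<subseteq> Basis \<and> int (length vs) = j}"
  have "AE x in lebesgue_on \<Omega>. \<forall>vs\<in>?I. \<omega> x vs = \<omega>' x vs"
    by (rule AE_finite_allI[OF finite_basis_lists]) (rule eq)
  then have "AE x in lebesgue_on \<Omega>. alt_inner j (\<omega> x) (\<theta> x) = alt_inner j (\<omega>' x) (\<theta> x)"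
    by (rule eventually_mono) (simp add: alt_inner_def)
  then show ?thesis
    unfolding form_inner_def
    by (rule integral_cong_AE[rotated 2]) (intro borel_measurable_integrable integrable_alt_inner assms)+
qed

lemma alt_form_eq_0:
  assumes u: "alt_form j u" and 0: "\<And>vs. set vs \<subseteq> Basis \<Longrightarrow> int (length vs) = j \<Longrightarrow> u vs = 0"
  shows "u vs = 0"
proof -
  \<comment> \<open>The slots are expanded in the basis from right to left: \<open>ws\<close> holds
    the slots already filled with basis vectors, \<open>us\<close> those still arbitrary.\<close>
  have "set ws \<subseteq> Basis \<Longrightarrow> u (us @ ws) = 0" for us ws
  proof (induction us arbitrary: ws rule: rev_induct)
    case Nil
    then show ?case
      using 0 u by (cases "int (length ws) = j") (auto simp: alt_form_def)
  next
    case (snoc w us)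
    have lin: "linear (\<lambda>v. u (us @ v # ws))"
      using u by (simp add: alt_form_def)
    have "u (us @ w # ws) = u (us @ (\<Sum>b\<in>Basis. (w \<bullet> b) *\<^sub>R b) # ws)"
      by (simp add: euclidean_representation)
    also have "\<dots> = (\<Sum>b\<in>Basis. (w \<bullet> b) *\<^sub>R u (us @ b # ws))"
      by (simp add: linear_sum[OF lin] linear_scale[OF lin, simplified])
    also have "\<dots> = 0"
      using snoc by (intro sum.neutral) simp
    finally show ?case
      by simp
  qed
  from this[of "[]" vs] show ?thesis
    by simp
qed

lemma AE_eq_0_if_form_inner_self_eq_0:
  assumes \<omega>: "\<omega> \<in> L2_forms \<Omega> j" and "form_inner \<Omega> j \<omega> \<omega> = 0"
  shows "AE x in lebesgue_on \<Omega>. \<omega> x vs = 0"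
proof -
  have "AE x in lebesgue_on \<Omega>. alt_inner j (\<omega> x) (\<omega> x) = 0"
    using assms integral_nonneg_eq_0_iff_AE[OF integrable_alt_inner[OF \<omega> \<omega>]]
    by (simp add: form_inner_def alt_inner_self_nonneg)
  then show ?thesis
  proof (rule AE_mp, intro AE_I2 impI)
    fix x assume x: "x \<in> space (lebesgue_on \<Omega>)" and 0: "alt_inner j (\<omega> x) (\<omega> x) = 0"
    have "(\<Sum>vs | set vs \<subseteq> Basis \<and> int (length vs) = j. \<omega> x vs * \<omega> x vs) = 0"
      using 0 by (simp add: alt_inner_def)
    then have "\<forall>vs\<in>{vs. set vs \<subseteq> Basis \<and> int (length vs) = j}. \<omega> x vs * \<omega> x vs = 0"
      by (subst (asm) sum_nonneg_eq_0_iff) (auto intro: finite_basis_lists)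
    then have *: "\<omega> x vs = 0" if "set vs \<subseteq> Basis" "int (length vs) = j" for vs
      using that by (metis (mono_tags, lifting) mem_Collect_eq mult_eq_0_iff)
    have "alt_form j (\<omega> x)"
      using L2_forms_alt_form[OF \<omega>] x by simp
    then show "\<omega> x vs = 0"
      by (rule alt_form_eq_0) (rule *)
  qed
qed

section \<open>Weak exterior derivatives\<close>

lemma sets_lebesgue_open_bounded:
  assumes "open \<Omega>" "bounded \<Omega>"
  shows "\<Omega> \<in> sets lebesgue" "finite_measure (lebesgue_on \<Omega>)"
proof -
  have "\<Omega> \<in> lmeasurable"
    using assms by (simp add: lmeasurable_open)
  then show "\<Omega> \<in> sets lebesgue" "finite_measure (lebesgue_on \<Omega>)"
    by (simp_all add: fmeasurableD finite_measure_lebesgue_on)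
qed

text \<open>Boundedness gives the domain finite measure and compact closure. Smooth functions and
  their derivatives can then be paired with components of square integrable forms, also when they do
  not vanish near the boundary, as the trace condition requires.\<close>

lemma continuous_square_integrable:
  fixes g :: "'a::euclidean_space \<Rightarrow> real"
  assumes \<Omega>: "open \<Omega>" "bounded \<Omega>" and g: "continuous_on UNIV g"
  shows "g \<in> borel_measurable (lebesgue_on \<Omega>)" "integrable (lebesgue_on \<Omega>) (\<lambda>x. (g x)\<^sup>2)"
proof -
  interpret finite_measure "lebesgue_on \<Omega>"
    using sets_lebesgue_open_bounded[OF \<Omega>] by blast
  have "g \<in> borel_measurable lborel"
    using g by (simp add: borel_measurable_continuous_onI)
  then show [measurable]: "g \<in> borel_measurable (lebesgue_on \<Omega>)"
    by (intro measurable_restrict_space1 measurable_completion)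
  have "compact (g ` closure \<Omega>)"
    using \<Omega>(2) g by (intro compact_continuous_image) (auto intro: continuous_on_subset)
  then obtain B where "\<forall>y\<in>g ` closure \<Omega>. norm y \<le> B"
    using compact_imp_bounded bounded_iff by metis
  then have B: "\<bar>g x\<bar> \<le> B" if "x \<in> closure \<Omega>" for x
    using that by simp
  have "(g x)\<^sup>2 \<le> B\<^sup>2" if "x \<in> \<Omega>" for x
    using B[of x] closure_subset that by (metis abs_le_square_iff abs_ge_self order_trans subsetD)
  then show "integrable (lebesgue_on \<Omega>) (\<lambda>x. (g x)\<^sup>2)"
    by (intro integrable_const_bound[where B = "B\<^sup>2"] AE_I2) auto
qed

lemma smooth_fun_continuous:
  assumes "smooth_fun \<psi>"
  shows "continuous_on UNIV \<psi>" "continuous_on UNIV (\<lambda>x. frechet_derivative \<psi> (at x) v)"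
  using assms[unfolded smooth_fun_def, THEN spec, of 0] assms[unfolded smooth_fun_def, THEN spec, of 1]
  by auto

lemma integrable_L2_times_continuous:
  fixes g :: "'a::euclidean_space \<Rightarrow> real"
  assumes "open \<Omega>" "bounded \<Omega>" "\<omega> \<in> L2_forms \<Omega> j" "continuous_on UNIV g"
  shows "integrable (lebesgue_on \<Omega>) (\<lambda>x. \<omega> x vs * g x)"
  by (intro integrable_mult_if_squares_integrable L2_forms_measurable[OF assms(3)]
      L2_forms_square_integrable[OF assms(3)] continuous_square_integrable[OF assms(1,2,4)])

lemma boundary_pairing_lin_comb:
  assumes "open \<Omega>" "bounded \<Omega>" "smooth_fun \<psi>"
    and "\<omega> \<in> L2_forms \<Omega> j" "\<omega>' \<in> L2_forms \<Omega> j" "\<eta> \<in> L2_forms \<Omega> i" "\<eta>' \<in> L2_forms \<Omega> i"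
  shows "boundary_pairing \<Omega> (lin_comb a \<omega> b \<omega>') (lin_comb a \<eta> b \<eta>') vs \<psi> =
    a * boundary_pairing \<Omega> \<omega> \<eta> vs \<psi> + b * boundary_pairing \<Omega> \<omega>' \<eta>' vs \<psi>"
proof -
  note int = integrable_L2_times_continuous[OF assms(1,2)]
  have 1: "(LINT x|lebesgue_on \<Omega>. lin_comb a \<theta> b \<theta>' x ws * g x) =
      a * (LINT x|lebesgue_on \<Omega>. \<theta> x ws * g x) + b * (LINT x|lebesgue_on \<Omega>. \<theta>' x ws * g x)"
    if "\<theta> \<in> L2_forms \<Omega> l" "\<theta>' \<in> L2_forms \<Omega> l" "continuous_on UNIV g" for \<theta> \<theta>' l g ws
  proof -
    have "(LINT x|lebesgue_on \<Omega>. lin_comb a \<theta> b \<theta>' x ws * g x) =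
        (LINT x|lebesgue_on \<Omega>. a * (\<theta> x ws * g x) + b * (\<theta>' x ws * g x))"
      by (simp add: lin_comb_def algebra_simps)
    then show ?thesis
      using int[OF that(1,3)] int[OF that(2,3)] by simp
  qed
  show ?thesis
    unfolding boundary_pairing_def 1[OF assms(4,5) smooth_fun_continuous(2)[OF assms(3)]]
      1[OF assms(6,7) smooth_fun_continuous(1)[OF assms(3)]]
    by (simp add: sum.distrib sum_distrib_left algebra_simps)
qed

text \<open>For a null form the derivative terms of the pairing drop out and the fundamental lemma
  applies to what remains. Admitting null forms, not just the zero form, makes this serve twice: for
  uniqueness of weak derivatives and for the exterior derivative of null finite element
  functions.\<close>

lemma AE_eq_0_if_weak_ext_deriv_0:
  assumes \<Omega>: "open \<Omega>" "bounded \<Omega>" and \<eta>: "\<eta> \<in> L2_forms \<Omega> i" "weak_ext_deriv \<Omega> \<omega> \<eta>"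
    and \<omega>: "\<omega> \<in> L2_forms \<Omega> j" "\<And>vs. AE x in lebesgue_on \<Omega>. \<omega> x vs = 0"
  shows "AE x in lebesgue_on \<Omega>. \<eta> x vs = 0"
proof (rule test_fun_orthogonal_imp_AE_zero[OF \<Omega>(1)])
  show "integrable (lebesgue_on \<Omega>) (\<lambda>x. \<eta> x vs)"
    using integrable_L2_times_continuous[OF \<Omega> \<eta>(1) continuous_on_const[of _ 1]] by simp
next
  fix \<psi> assume \<psi>: "test_fun \<Omega> \<psi>"
  have "(LINT x|lebesgue_on \<Omega>. \<omega> x ws * frechet_derivative \<psi> (at x) v) = 0" for ws v
    by (rule integral_eq_zero_AE) (use \<omega>(2)[of ws] in \<open>auto elim: eventually_mono\<close>)
  then show "(LINT x|lebesgue_on \<Omega>. \<eta> x vs * \<psi> x) = 0"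
    using \<eta>(2)[unfolded weak_ext_deriv_def, rule_format, OF \<psi>, of vs]
    by (simp add: boundary_pairing_def)
qed

lemma weak_ext_deriv_lin_comb:
  assumes "open \<Omega>" "bounded \<Omega>" "\<omega> \<in> L2_forms \<Omega> j" "\<omega>' \<in> L2_forms \<Omega> j"
    "\<eta> \<in> L2_forms \<Omega> i" "\<eta>' \<in> L2_forms \<Omega> i" "weak_ext_deriv \<Omega> \<omega> \<eta>" "weak_ext_deriv \<Omega> \<omega>' \<eta>'"
  shows "weak_ext_deriv \<Omega> (lin_comb a \<omega> b \<omega>') (lin_comb a \<eta> b \<eta>')"
  using assms(7,8) unfolding weak_ext_deriv_def
  by (auto simp: boundary_pairing_lin_comb[OF assms(1,2) _ assms(3-6)] test_fun_def)

lemma weak_ext_deriv_unique: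
  assumes \<Omega>: "open \<Omega>" "bounded \<Omega>" and L2: "\<omega> \<in> L2_forms \<Omega> j" "\<eta> \<in> L2_forms \<Omega> i" "\<eta>' \<in> L2_forms \<Omega> i"
    and "weak_ext_deriv \<Omega> \<omega> \<eta>" "weak_ext_deriv \<Omega> \<omega> \<eta>'"
  shows "AE x in lebesgue_on \<Omega>. \<eta> x vs = \<eta>' x vs"
proof -
  have "weak_ext_deriv \<Omega> (lin_comb 1 \<omega> (-1) \<omega>) (lin_comb 1 \<eta> (-1) \<eta>')"
    by (rule weak_ext_deriv_lin_comb[OF \<Omega> L2(1,1,2,3) assms(6,7)])
  then have "AE x in lebesgue_on \<Omega>. lin_comb 1 \<eta> (-1) \<eta>' x vs = 0"
    by (rule AE_eq_0_if_weak_ext_deriv_0[OF \<Omega> L2_forms_lin_comb[OF L2(2,3)] _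
          L2_forms_lin_comb[OF L2(1,1)]]) (simp add: lin_comb_def)
  then show ?thesis
    by (simp add: lin_comb_def)
qed

lemma H_forms_ext_deriv:
  assumes "\<omega> \<in> H_forms \<Omega> j"
  shows "ext_deriv \<Omega> j \<omega> \<in> L2_forms \<Omega> (j + 1)" "weak_ext_deriv \<Omega> \<omega> (ext_deriv \<Omega> j \<omega>)"
proof -
  have "\<exists>\<eta>. \<eta> \<in> L2_forms \<Omega> (j + 1) \<and> weak_ext_deriv \<Omega> \<omega> \<eta>"
    using assms by (auto simp: H_forms_def)
  from someI_ex[OF this]
  show "ext_deriv \<Omega> j \<omega> \<in> L2_forms \<Omega> (j + 1)" "weak_ext_deriv \<Omega> \<omega> (ext_deriv \<Omega> j \<omega>)"
    by (auto simp: ext_deriv_def)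
qed

lemma H_forms_L2: "\<omega> \<in> H_forms \<Omega> j \<Longrightarrow> \<omega> \<in> L2_forms \<Omega> j"
  by (simp add: H_forms_def)

text \<open>The representative chosen by \<open>ext_deriv\<close> for a combination need not be the
  combination of the chosen representatives. Both are weak derivatives of the same form, hence they
  agree almost everywhere.\<close>

lemma H_forms_lin_comb:
  assumes \<Omega>: "open \<Omega>" "bounded \<Omega>" and H: "\<omega> \<in> H_forms \<Omega> j" "\<omega>' \<in> H_forms \<Omega> j"
  shows "lin_comb a \<omega> b \<omega>' \<in> H_forms \<Omega> j"
    and "AE x in lebesgue_on \<Omega>. ext_deriv \<Omega> j (lin_comb a \<omega> b \<omega>') x vs =
           lin_comb a (ext_deriv \<Omega> j \<omega>) b (ext_deriv \<Omega> j \<omega>') x vs"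
proof -
  let ?d = "lin_comb a (ext_deriv \<Omega> j \<omega>) b (ext_deriv \<Omega> j \<omega>')"
  have L2: "lin_comb a \<omega> b \<omega>' \<in> L2_forms \<Omega> j" "?d \<in> L2_forms \<Omega> (j + 1)"
    using H by (simp_all add: L2_forms_lin_comb H_forms_L2 H_forms_ext_deriv)
  have weak: "weak_ext_deriv \<Omega> (lin_comb a \<omega> b \<omega>') ?d"
    using H by (intro weak_ext_deriv_lin_comb[OF \<Omega>, where j = j and i = "j + 1"] H_forms_L2 H_forms_ext_deriv)
  show mem: "lin_comb a \<omega> b \<omega>' \<in> H_forms \<Omega> j"
    using L2 weak by (auto simp: H_forms_def)
  show "AE x in lebesgue_on \<Omega>. ext_deriv \<Omega> j (lin_comb a \<omega> b \<omega>') x vs = ?d x vs"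
    by (rule weak_ext_deriv_unique[OF \<Omega> L2(1) H_forms_ext_deriv(1)[OF mem] L2(2)
          H_forms_ext_deriv(2)[OF mem] weak])
qed

lemma form_inner_ext_deriv_lin_comb:
  assumes "open \<Omega>" "bounded \<Omega>" "\<omega> \<in> H_forms \<Omega> j" "\<omega>' \<in> H_forms \<Omega> j" "\<theta> \<in> L2_forms \<Omega> (j + 1)"
  shows "form_inner \<Omega> (j + 1) (ext_deriv \<Omega> j (lin_comb a \<omega> b \<omega>')) \<theta> =
    a * form_inner \<Omega> (j + 1) (ext_deriv \<Omega> j \<omega>) \<theta> + b * form_inner \<Omega> (j + 1) (ext_deriv \<Omega> j \<omega>') \<theta>"
proof -
  have "form_inner \<Omega> (j + 1) (ext_deriv \<Omega> j (lin_comb a \<omega> b \<omega>')) \<theta> =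
      form_inner \<Omega> (j + 1) (lin_comb a (ext_deriv \<Omega> j \<omega>) b (ext_deriv \<Omega> j \<omega>')) \<theta>"
    by (intro form_inner_cong_AE H_forms_ext_deriv L2_forms_lin_comb H_forms_lin_comb assms)
  then show ?thesis
    by (simp add: form_inner_lin_comb_left H_forms_ext_deriv assms)
qed

lemma H0_forms_lin_comb:
  assumes \<Omega>: "open \<Omega>" "bounded \<Omega>" and H0: "\<omega> \<in> H0_forms \<Omega> j" "\<omega>' \<in> H0_forms \<Omega> j"
  shows "lin_comb a \<omega> b \<omega>' \<in> H0_forms \<Omega> j"
proof -
  let ?d = "ext_deriv \<Omega> j"
  have H: "\<omega> \<in> H_forms \<Omega> j" "\<omega>' \<in> H_forms \<Omega> j"
    and tr: "trace_zero \<Omega> j \<omega>" "trace_zero \<Omega> j \<omega>'"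
    using H0 by (auto simp: H0_forms_def)
  have "boundary_pairing \<Omega> (lin_comb a \<omega> b \<omega>') (?d (lin_comb a \<omega> b \<omega>')) vs \<psi> = 0"
    if \<psi>: "smooth_fun \<psi>" for vs \<psi>
  proof -
    \<comment> \<open>The condition \<open>trace_zero\<close> refers to the chosen derivative, so
      the representative has to be exchanged under the integral before linearity of the pairing can
      be used.\<close>
    have "AE x in lebesgue_on \<Omega>. ?d (lin_comb a \<omega> b \<omega>') x vs * \<psi> x = lin_comb a (?d \<omega>) b (?d \<omega>') x vs * \<psi> x"
      using H_forms_lin_comb(2)[OF \<Omega> H, of a b vs] by (rule eventually_mono) simp
    then have "(LINT x|lebesgue_on \<Omega>. ?d (lin_comb a \<omega> b \<omega>') x vs * \<psi> x) =
        (LINT x|lebesgue_on \<Omega>. lin_comb a (?d \<omega>) b (?d \<omega>') x vs * \<psi> x)"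
      by (rule integral_cong_AE[rotated 2])
         (intro borel_measurable_integrable integrable_L2_times_continuous[OF \<Omega>, where j = "j + 1"]
           H_forms_ext_deriv H_forms_lin_comb L2_forms_lin_comb smooth_fun_continuous(1) \<Omega> H \<psi>)+
    then have "boundary_pairing \<Omega> (lin_comb a \<omega> b \<omega>') (?d (lin_comb a \<omega> b \<omega>')) vs \<psi> =
        boundary_pairing \<Omega> (lin_comb a \<omega> b \<omega>') (lin_comb a (?d \<omega>) b (?d \<omega>')) vs \<psi>"
      by (simp add: boundary_pairing_def)
    also have "\<dots> = a * boundary_pairing \<Omega> \<omega> (?d \<omega>) vs \<psi> + b * boundary_pairing \<Omega> \<omega>' (?d \<omega>') vs \<psi>"
      by (intro boundary_pairing_lin_comb[OF \<Omega> \<psi>, where j = j and i = "j + 1"] H_forms_L2 H_forms_ext_deriv H)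
    finally show ?thesis
      using tr \<psi> by (simp add: trace_zero_def)
  qed
  then show ?thesis
    using H_forms_lin_comb(1)[OF \<Omega> H] by (simp add: H0_forms_def trace_zero_def)
qed

section \<open>Finite element spaces and the discrete coderivative\<close>

text \<open>Induction on the number of functionals: each step splits off a vector that is not null,
  and its orthogonal complement is separated by one functional less.\<close>

lemma Riesz_finite_rank:
  fixes comb :: "real \<Rightarrow> 'v \<Rightarrow> real \<Rightarrow> 'v \<Rightarrow> 'v" and B :: "'v \<Rightarrow> 'v \<Rightarrow> real"
    and \<phi> :: "'i \<Rightarrow> 'v \<Rightarrow> real"
  assumes "finite I" "V \<noteq> {}"
    and "\<And>a v b w. v \<in> V \<Longrightarrow> w \<in> V \<Longrightarrow> comb a v b w \<in> V"
    and "\<And>a v b w u. v \<in> V \<Longrightarrow> w \<in> V \<Longrightarrow> u \<in> V \<Longrightarrow> B (comb a v b w) u = a * B v u + b * B w u"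
    and "\<And>v w. B v w = B w v"
    and "\<And>v w. v \<in> V \<Longrightarrow> w \<in> V \<Longrightarrow> B v v = 0 \<Longrightarrow> B v w = 0"
    and "\<And>a v b w. v \<in> V \<Longrightarrow> w \<in> V \<Longrightarrow> l (comb a v b w) = a * l v + b * l w"
    and "\<And>v. v \<in> V \<Longrightarrow> B v v = 0 \<Longrightarrow> l v = 0"
    and "\<And>i a v b w. i \<in> I \<Longrightarrow> v \<in> V \<Longrightarrow> w \<in> V \<Longrightarrow> \<phi> i (comb a v b w) = a * \<phi> i v + b * \<phi> i w"
    and "\<And>v. v \<in> V \<Longrightarrow> (\<And>i. i \<in> I \<Longrightarrow> \<phi> i v = 0) \<Longrightarrow> B v v = 0"
  shows "\<exists>\<tau>\<in>V. \<forall>v\<in>V. B \<tau> v = l v"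
  using assms
proof (induction "card I" arbitrary: I V \<phi> rule: less_induct)
  case less
  note V = less.prems(3) and B_lin = less.prems(4) and B_sym = less.prems(5) and null = less.prems(6)
    and l_lin = less.prems(7) and l_null = less.prems(8) and \<phi>_lin = less.prems(9) and sep = less.prems(10)
  show ?case
  proof (cases "\<forall>v\<in>V. B v v = 0")
    case True
    moreover obtain v where "v \<in> V"
      using less.prems(2) by blast
    ultimately show ?thesis
      using null l_null by (metis (no_types))
  next
    case False
    then obtain e where e: "e \<in> V" "B e e \<noteq> 0"
      by blast
    then obtain i where i: "i \<in> I" "\<phi> i e \<noteq> 0"
      using sep by blast
    define V' where "V' = {v \<in> V. B v e = 0}"
    \<comment> \<open>Elimination of one functional: each \<open>\<psi> j\<close> is
      \<open>\<phi> j\<close> corrected by a multiple of \<open>\<phi> i\<close> so that it vanishes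
      at e.\<close>
    define \<psi> where "\<psi> j v = \<phi> j v - \<phi> j e / \<phi> i e * \<phi> i v" for j v
    have "\<exists>\<tau>\<in>V'. \<forall>v\<in>V'. B \<tau> v = l v"
    proof (rule less.hyps[where I = "I - {i}" and V = V' and \<phi> = \<psi>])
      show "card (I - {i}) < card I"
        using i(1) less.prems(1) by (rule card_Diff1_less[rotated])
      \<comment> \<open>The combination of e with itself with both coefficients 0 plays the part of
        the zero vector.\<close>
      show "V' \<noteq> {}"
        using V[OF e(1) e(1), of 0 0] B_lin[OF e(1) e(1) e(1), of 0 0] by (auto simp: V'_def)
      show "comb a v b w \<in> V'" if "v \<in> V'" "w \<in> V'" for a v b w
        using that V[of v w a b] B_lin[of v w e a b] e(1) by (simp add: V'_def)
      show "\<psi> j (comb a v b w) = a * \<psi> j v + b * \<psi> j w" if "j \<in> I - {i}" "v \<in> V'" "w \<in> V'" for j a v b w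
      proof -
        have "\<phi> j (comb a v b w) = a * \<phi> j v + b * \<phi> j w" "\<phi> i (comb a v b w) = a * \<phi> i v + b * \<phi> i w"
          using that i(1) by (auto simp: V'_def intro: \<phi>_lin)
        then show ?thesis
          using i(2) by (simp add: \<psi>_def field_simps)
      qed
      show "B v v = 0" if v: "v \<in> V'" "\<And>j. j \<in> I - {i} \<Longrightarrow> \<psi> j v = 0" for v
      proof -
        \<comment> \<open>Subtracting this multiple of e makes \<open>\<phi> i\<close> vanish; the
          other functionals then vanish because \<open>\<psi> j v = 0\<close>. So w is null, and
          since v is orthogonal to e, pairing w with v gives \<open>B v v\<close>.\<close>
        define w where "w = comb 1 v (- \<phi> i v / \<phi> i e) e"
        have vV: "v \<in> V" "B v e = 0"
          using v(1) by (auto simp: V'_def)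
        have w: "w \<in> V"
          using V[OF vV(1) e(1)] by (simp add: w_def)
        have "\<phi> j w = 0" if "j \<in> I" for j
        proof (cases "j = i")
          case True
          then show ?thesis
            using \<phi>_lin[OF i(1) vV(1) e(1)] i(2) by (simp add: w_def)
        next
          case False
          then have "\<phi> j v - \<phi> j e / \<phi> i e * \<phi> i v = 0"
            using v(2)[of j] that by (simp add: \<psi>_def)
          then show ?thesis
            using \<phi>_lin[OF that vV(1) e(1)] by (simp add: w_def mult.commute)
        qed
        then have "B w v = 0"
          using sep[OF w] null[OF w vV(1)] by blast
        then show ?thesis
          using B_lin[OF vV(1) e(1) vV(1), of 1 "- \<phi> i v / \<phi> i e"] vV(2) B_sym[of e v]
          by (simp add: w_def)
      qed
      show "finite (I - {i})"
        using less.prems(1) by simp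
      show "B v w = B w v" for v w
        by (rule B_sym)
    qed (simp_all add: V'_def B_lin l_lin null l_null)
    then obtain \<tau> where \<tau>: "\<tau> \<in> V" "B \<tau> e = 0" "\<And>v. v \<in> V \<Longrightarrow> B v e = 0 \<Longrightarrow> B \<tau> v = l v"
      by (auto simp: V'_def)
    \<comment> \<open>The representer on the complement of e only lacks the right value at e; the
      added multiple of e supplies it. The check splits v into its component along e and a remainder
      w in the complement.\<close>
    have "B (comb 1 \<tau> (l e / B e e) e) v = l v" if v: "v \<in> V" for v
    proof -
      define w where "w = comb 1 v (- B v e / B e e) e"
      have "B w e = 0"
        using B_lin[OF v e(1) e(1)] e(2) by (simp add: w_def)
      then have "B \<tau> w = l w"
        using \<tau>(3) V[OF v e(1)] by (simp add: w_def)
      moreover have "B \<tau> w = B \<tau> v"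
        using B_lin[OF v e(1) \<tau>(1), of 1 "- B v e / B e e"] \<tau>(2) B_sym[of \<tau>] by (simp add: w_def)
      moreover have "l w = l v - B v e / B e e * l e"
        using l_lin[OF v e(1)] by (simp add: w_def)
      ultimately show ?thesis
        using B_lin[OF \<tau>(1) e(1) v, of 1 "l e / B e e"] B_sym[of e v] by (simp add: field_simps)
    qed
    then show ?thesis
      using V[OF \<tau>(1) e(1)] by blast
  qed
qed

section \<open>Polynomial coefficients as finite spans of functions\<close>

definition fun_span :: "('a \<Rightarrow> real) set \<Rightarrow> ('a \<Rightarrow> real) set" where
  "fun_span G = {p. \<exists>c. \<forall>x. p x = (\<Sum>g\<in>G. c g * g x)}"

text \<open>Finiteness matters here: over an infinite G the sum is 0 by convention, and the span
  collapses to the zero function.\<close>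

lemma fun_span_base: "finite G \<Longrightarrow> g \<in> G \<Longrightarrow> g \<in> fun_span G"
  unfolding fun_span_def
  by (intro CollectI exI[of _ "\<lambda>h. if h = g then 1 else 0"]) (simp add: if_distrib if_distribR cong: if_cong)

lemma fun_span_add:
  assumes "p \<in> fun_span G" "q \<in> fun_span G"
  shows "(\<lambda>x. p x + q x) \<in> fun_span G"
proof -
  obtain c d where "\<And>x. p x = (\<Sum>g\<in>G. c g * g x)" "\<And>x. q x = (\<Sum>g\<in>G. d g * g x)"
    using assms by (auto simp: fun_span_def)
  then have "\<forall>x. p x + q x = (\<Sum>g\<in>G. (c g + d g) * g x)"
    by (simp add: sum.distrib algebra_simps)
  then show ?thesis
    unfolding fun_span_def by (intro CollectI exI[of _ "\<lambda>g. c g + d g"])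
qed

lemma fun_span_scale:
  assumes "p \<in> fun_span G"
  shows "(\<lambda>x. r * p x) \<in> fun_span G"
proof -
  obtain c where "\<And>x. p x = (\<Sum>g\<in>G. c g * g x)"
    using assms by (auto simp: fun_span_def)
  then have "\<forall>x. r * p x = (\<Sum>g\<in>G. (r * c g) * g x)"
    by (simp add: sum_distrib_left mult.assoc)
  then show ?thesis
    unfolding fun_span_def by (intro CollectI exI[of _ "\<lambda>g. r * c g"])
qed

lemma fun_span_sum: "(\<And>i. i \<in> I \<Longrightarrow> p i \<in> fun_span G) \<Longrightarrow> (\<lambda>x. \<Sum>i\<in>I. p i x) \<in> fun_span G"
proof (induction I rule: infinite_finite_induct)
  case (insert i I)
  then show ?case
    using fun_span_add[of "p i" G "\<lambda>x. \<Sum>i\<in>I. p i x"] by simp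
qed (auto simp: fun_span_def intro!: exI[of _ "\<lambda>_. 0"])

definition monomial :: "('a::euclidean_space \<Rightarrow> nat) \<Rightarrow> 'a \<Rightarrow> real" where
  "monomial \<alpha> x = (\<Prod>b\<in>Basis. (x \<bullet> b) ^ \<alpha> b)"

definition exponents :: "int set \<Rightarrow> ('a::euclidean_space \<Rightarrow> nat) set" where
  "exponents D = {\<alpha>. (\<forall>b. b \<notin> Basis \<longrightarrow> \<alpha> b = 0) \<and> int (\<Sum>b\<in>Basis. \<alpha> b) \<in> D}"

lemma polys_of_degrees_eq:
  "polys_of_degrees D = {p. \<exists>c. p = (\<lambda>x. \<Sum>\<alpha>\<in>exponents D. c \<alpha> * monomial \<alpha> x)}"
  by (simp add: polys_of_degrees_def exponents_def monomial_def)

lemma finite_exponents: "finite (exponents {..s} :: ('a::euclidean_space \<Rightarrow> nat) set)"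
proof (rule finite_subset)
  show "exponents {..s} \<subseteq> {\<alpha> :: 'a \<Rightarrow> nat. \<forall>b. (b \<in> Basis \<longrightarrow> \<alpha> b \<in> {..nat s}) \<and> (b \<notin> Basis \<longrightarrow> \<alpha> b = 0)}"
  proof (clarsimp simp: exponents_def)
    fix \<alpha> :: "'a \<Rightarrow> nat" and b :: 'a
    assume "(\<Sum>b\<in>Basis. int (\<alpha> b)) \<le> s" "b \<in> Basis"
    moreover have "\<alpha> b \<le> (\<Sum>b\<in>Basis. \<alpha> b)"
      using \<open>b \<in> Basis\<close> by (intro member_le_sum) auto
    ultimately show "\<alpha> b \<le> nat s"
      by (simp flip: of_nat_sum)
  qed
qed (intro finite_set_of_finite_funs; simp)

lemma polys_of_degrees_fun_span:
  assumes "D \<subseteq> {..s}"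
  shows "polys_of_degrees D \<subseteq> fun_span (monomial ` exponents {..s})"
proof -
  have "exponents D \<subseteq> (exponents {..s} :: ('a \<Rightarrow> nat) set)"
    using assms by (auto simp: exponents_def)
  then show ?thesis
    by (auto simp: polys_of_degrees_eq finite_exponents
        intro!: fun_span_sum fun_span_scale fun_span_base)
qed

lemma polys_of_degrees_lin_comb:
  assumes "p \<in> polys_of_degrees D" "q \<in> polys_of_degrees D"
  shows "(\<lambda>x. a * p x + b * q x) \<in> polys_of_degrees D"
proof -
  obtain c d where "p = (\<lambda>x. \<Sum>\<alpha>\<in>exponents D. c \<alpha> * monomial \<alpha> x)"
    "q = (\<lambda>x. \<Sum>\<alpha>\<in>exponents D. d \<alpha> * monomial \<alpha> x)"
    using assms by (auto simp: polys_of_degrees_eq)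
  then have "(\<lambda>x. a * p x + b * q x) = (\<lambda>x. \<Sum>\<alpha>\<in>exponents D. (a * c \<alpha> + b * d \<alpha>) * monomial \<alpha> x)"
    by (simp add: sum.distrib sum_distrib_left algebra_simps)
  then show ?thesis
    unfolding polys_of_degrees_eq by (intro CollectI exI)
qed

lemma poly_forms_of_degrees_lin_comb:
  "p \<in> poly_forms_of_degrees D j \<Longrightarrow> q \<in> poly_forms_of_degrees D j \<Longrightarrow>
    lin_comb a p b q \<in> poly_forms_of_degrees D j"
  by (simp add: poly_forms_of_degrees_def lin_comb_def alt_form_lin_comb polys_of_degrees_lin_comb)

lemma shape_forms_lin_comb:
  assumes "p \<in> shape_forms fam j" "q \<in> shape_forms fam j"
  shows "lin_comb a p b q \<in> shape_forms fam j"
proof (cases fam)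
  case (Full r)
  then show ?thesis
    using assms by (simp add: poly_forms_def poly_forms_of_degrees_lin_comb)
next
  case (Trimmed s)
  then obtain p1 p2 q1 q2 where
    "p = (\<lambda>x vs. p1 x vs + koszul p2 x vs)" "q = (\<lambda>x vs. q1 x vs + koszul q2 x vs)"
    and mem: "p1 \<in> poly_forms (s - 1) j" "q1 \<in> poly_forms (s - 1) j"
      "p2 \<in> hom_poly_forms (s - 1) (j + 1)" "q2 \<in> hom_poly_forms (s - 1) (j + 1)"
    using assms by (auto simp: trimmed_poly_forms_def)
  then have "lin_comb a p b q = (\<lambda>x vs. lin_comb a p1 b q1 x vs + koszul (lin_comb a p2 b q2) x vs)"
    by (simp add: lin_comb_def koszul_def algebra_simps)
  moreover have "lin_comb a p1 b q1 \<in> poly_forms (s - 1) j"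
    "lin_comb a p2 b q2 \<in> hom_poly_forms (s - 1) (j + 1)"
    using mem by (auto simp: poly_forms_def hom_poly_forms_def poly_forms_of_degrees_lin_comb)
  ultimately show ?thesis
    using Trimmed by (auto simp: trimmed_poly_forms_def)
qed

text \<open>Polynomial forms are polynomial on each fixed list of vectors, whereas
  \<open>koszul\<close> inserts the moving point x. Expanding x in the basis leaves fixed lists with
  coordinate functions as factors.\<close>

lemma koszul_eq_sum:
  assumes "\<And>x. alt_form j (q x)"
  shows "koszul q x vs = (\<Sum>b\<in>Basis. (x \<bullet> b) * q x (b # vs))"
proof -
  have lin: "linear (\<lambda>v. q x ([] @ v # vs))"
    using assms[of x] unfolding alt_form_def by blast
  have "koszul q x vs = q x ([] @ (\<Sum>b\<in>Basis. (x \<bullet> b) *\<^sub>R b) # vs)"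
    by (simp add: koszul_def euclidean_representation)
  also have "\<dots> = (\<Sum>b\<in>Basis. (x \<bullet> b) *\<^sub>R q x ([] @ b # vs))"
    by (simp only: linear_sum[OF lin] linear_scale[OF lin])
  finally show ?thesis
    by simp
qed

lemma fun_span_mult:
  assumes "p \<in> fun_span G" "finite H" "\<And>g. g \<in> G \<Longrightarrow> (\<lambda>x. u x * g x) \<in> H"
  shows "(\<lambda>x. u x * p x) \<in> fun_span H"
proof -
  obtain c where c: "\<And>x. p x = (\<Sum>g\<in>G. c g * g x)"
    using assms by (auto simp: fun_span_def)
  have "(\<lambda>x. \<Sum>g\<in>G. c g * (u x * g x)) \<in> fun_span H"
    using assms(2,3) by (intro fun_span_sum fun_span_scale fun_span_base)
  then show ?thesis
    by (simp add: c sum_distrib_left algebra_simps)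
qed

lemma fun_span_mono:
  assumes "G \<subseteq> H" "finite H"
  shows "fun_span G \<subseteq> fun_span H"
  using fun_span_mult[of _ G H "\<lambda>_. 1"] assms by auto

text \<open>The generators are the test functions for the moments that separate finite element
  functions modulo null forms. One finite set has to serve all shape forms and all lists of vectors
  at once.\<close>

lemma shape_forms_finite_span:
  "\<exists>G. finite G \<and> (\<forall>g\<in>G. continuous_on UNIV g) \<and>
     (\<forall>p\<in>shape_forms fam j. \<forall>vs. (\<lambda>x. p x vs) \<in> fun_span (G :: ('a::euclidean_space \<Rightarrow> real) set))"
proof -
  have cont: "continuous_on UNIV (monomial \<alpha>)" for \<alpha> :: "'a \<Rightarrow> nat"
    unfolding monomial_def by (intro continuous_intros)
  show ?thesis
  proof (cases fam)
    case (Full r)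
    then show ?thesis
      using polys_of_degrees_fun_span[of "{..r - j}" "r - j"] cont finite_exponents
      by (intro exI[of _ "monomial ` exponents {..r - j}"])
         (auto simp: poly_forms_def poly_forms_of_degrees_def)
  next
    case (Trimmed s)
    define G where "G = (monomial ` exponents {..s - 1} :: ('a \<Rightarrow> real) set)"
    \<comment> \<open>The products with coordinate functions accommodate the Koszul part, and G
      itself accommodates the full polynomial part.\<close>
    define H where "H = G \<union> (\<lambda>(b, g) x. (x \<bullet> b) * g x) ` (Basis \<times> G)"
    have fin: "finite G" "finite H"
      by (auto simp: G_def H_def finite_exponents)
    have "(\<lambda>x. p x vs) \<in> fun_span H" if p: "p \<in> shape_forms fam j" for p vs
    proof -
      obtain p1 p2 where p: "p = (\<lambda>x vs. p1 x vs + koszul p2 x vs)"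
        and mem: "p1 \<in> poly_forms (s - 1) j" "p2 \<in> hom_poly_forms (s - 1) (j + 1)"
        using p Trimmed by (auto simp: trimmed_poly_forms_def)
      have p1: "(\<lambda>x. p1 x vs) \<in> fun_span H"
        using mem(1) polys_of_degrees_fun_span[of "{..s - 1}" "s - 1"] fun_span_mono[of G H] fin
        by (auto simp: poly_forms_def poly_forms_of_degrees_def G_def H_def)
      have "(\<lambda>x. p2 x ws) \<in> fun_span G" for ws
        using mem(2) polys_of_degrees_fun_span[of "{s - 1}" "s - 1"]
        by (auto simp: hom_poly_forms_def poly_forms_of_degrees_def G_def)
      then have "(\<lambda>x. \<Sum>b\<in>Basis. (x \<bullet> b) * p2 x (b # vs)) \<in> fun_span H"
        using fin by (intro fun_span_sum fun_span_mult[where G = G]) (auto simp: H_def)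
      moreover have "koszul p2 x vs = (\<Sum>b\<in>Basis. (x \<bullet> b) * p2 x (b # vs))" for x
        using mem(2) by (intro koszul_eq_sum[of "j + 1"]) (simp add: hom_poly_forms_def poly_forms_of_degrees_def)
      ultimately show ?thesis
        using fun_span_add[OF p1] by (simp add: p)
    qed
    moreover have "\<forall>g\<in>H. continuous_on UNIV g"
      using cont by (auto simp: H_def G_def intro!: continuous_intros)
    ultimately show ?thesis
      using fin by blast
  qed
qed

section \<open>Finite element functions modulo null forms, and existence of the coderivative\<close>

lemma fe_space_H: "\<omega> \<in> fe_space \<Omega> \<T> fam j \<Longrightarrow> \<omega> \<in> H_forms \<Omega> j"
  by (simp add: fe_space_def H0_forms_def)

lemma fe_space_L2: "\<omega> \<in> fe_space \<Omega> \<T> fam j \<Longrightarrow> \<omega> \<in> L2_forms \<Omega> j"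
  by (intro H_forms_L2 fe_space_H)

lemma fe_space_lin_comb:
  assumes "open \<Omega>" "bounded \<Omega>" "\<omega> \<in> fe_space \<Omega> \<T> fam j" "\<omega>' \<in> fe_space \<Omega> \<T> fam j"
  shows "lin_comb a \<omega> b \<omega>' \<in> fe_space \<Omega> \<T> fam j"
proof -
  have "\<exists>p\<in>shape_forms fam j. AE x in lebesgue_on \<Omega>. x \<in> K \<longrightarrow> lin_comb a \<omega> b \<omega>' x = p x"
    if K: "K \<in> \<T>" for K
  proof -
    obtain p where p: "p \<in> shape_forms fam j" "AE x in lebesgue_on \<Omega>. x \<in> K \<longrightarrow> \<omega> x = p x"
      using assms(3) K by (auto simp: fe_space_def)
    obtain q where q: "q \<in> shape_forms fam j" "AE x in lebesgue_on \<Omega>. x \<in> K \<longrightarrow> \<omega>' x = q x"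
      using assms(4) K by (auto simp: fe_space_def)
    have "AE x in lebesgue_on \<Omega>. x \<in> K \<longrightarrow> lin_comb a \<omega> b \<omega>' x = lin_comb a p b q x"
      using p(2) q(2) by eventually_elim (simp add: lin_comb_def)
    then show ?thesis
      using shape_forms_lin_comb[OF p(1) q(1)] by blast
  qed
  then show ?thesis
    using assms H0_forms_lin_comb[OF assms(1,2)] by (simp add: fe_space_def)
qed

lemma triangulation_of_closed:
  assumes "triangulation_of \<T> \<Omega>" "K \<in> \<T>"
  shows "closed K"
proof -
  obtain C where "finite C" "K = convex hull C"
    using assms by (auto simp: triangulation_of_def simplex)
  then show ?thesis
    by (simp add: compact_imp_closed finite_imp_compact_convex_hull)
qed

text \<open>On each simplex a component of the form is itself a combination of the functions in G.
  The same combination of its moments is the integral of its square over the simplex, which is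
  therefore zero.\<close>

lemma fe_space_null_if_moments_0:
  fixes \<omega> :: "'a::euclidean_space form"
  assumes \<Omega>: "open \<Omega>" "bounded \<Omega>" and mesh: "triangulation_of \<T> \<Omega>"
    and G: "\<And>g. g \<in> G \<Longrightarrow> continuous_on UNIV g"
      "\<And>p vs. p \<in> shape_forms fam j \<Longrightarrow> (\<lambda>x. p x vs) \<in> fun_span G"
    and \<omega>: "\<omega> \<in> fe_space \<Omega> \<T> fam j"
    and moments: "\<And>K vs g. K \<in> \<T> \<Longrightarrow> set vs \<subseteq> Basis \<Longrightarrow> int (length vs) = j \<Longrightarrow> g \<in> G \<Longrightarrow>
      (LINT x|lebesgue_on \<Omega>. indicator (K \<inter> \<Omega>) x * (\<omega> x vs * g x)) = 0"
  shows "form_inner \<Omega> j \<omega> \<omega> = 0"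
proof -
  note L2 = fe_space_L2[OF \<omega>]
  let ?I = "{vs :: 'a list. set vs \<subseteq> Basis \<and> int (length vs) = j}"
  have "AE x in lebesgue_on \<Omega>. x \<in> K \<longrightarrow> \<omega> x vs = 0" if K: "K \<in> \<T>" and vs: "vs \<in> ?I" for K vs
  proof -
    let ?K = "indicator (K \<inter> \<Omega>) :: 'a \<Rightarrow> real"
    have K_sets: "K \<inter> \<Omega> \<in> sets (lebesgue_on \<Omega>)"
      using triangulation_of_closed[OF mesh K] \<Omega> by (simp add: sets_restrict_space_iff)
    obtain p where p: "p \<in> shape_forms fam j" "AE x in lebesgue_on \<Omega>. x \<in> K \<longrightarrow> \<omega> x = p x"
      using \<omega> K by (auto simp: fe_space_def)
    obtain c where c: "\<And>x. p x vs = (\<Sum>g\<in>G. c g * g x)"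
      using G(2)[OF p(1), of vs] by (auto simp: fun_span_def)
    have int: "integrable (lebesgue_on \<Omega>) (\<lambda>x. ?K x * (\<omega> x vs * g x))" if "g \<in> G" for g
      using integrable_mult_indicator[OF K_sets integrable_L2_times_continuous[OF \<Omega> L2 G(1)[OF that], of vs]]
      by simp
    have int2: "integrable (lebesgue_on \<Omega>) (\<lambda>x. ?K x * (\<omega> x vs)\<^sup>2)"
      using integrable_mult_indicator[OF K_sets L2_forms_square_integrable[OF L2, of vs]] by simp
    have "(LINT x|lebesgue_on \<Omega>. ?K x * (\<omega> x vs)\<^sup>2) =
        (LINT x|lebesgue_on \<Omega>. (\<Sum>g\<in>G. c g * (?K x * (\<omega> x vs * g x))))"
    proof (rule integral_cong_AE)
      show "AE x in lebesgue_on \<Omega>. ?K x * (\<omega> x vs)\<^sup>2 = (\<Sum>g\<in>G. c g * (?K x * (\<omega> x vs * g x)))"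
        using p(2)
      proof eventually_elim
        case (elim x)
        have "(\<Sum>g\<in>G. c g * (?K x * (\<omega> x vs * g x))) = ?K x * (\<omega> x vs * p x vs)"
          by (simp add: c sum_distrib_left algebra_simps)
        then show ?case
          using elim by (cases "x \<in> K") (simp_all add: power2_eq_square)
      qed
    qed (use int int2 in \<open>auto intro!: borel_measurable_integrable\<close>)
    also have "\<dots> = 0"
      using int moments[OF K, of vs] vs by (simp add: Bochner_Integration.integral_sum)
    finally have "AE x in lebesgue_on \<Omega>. ?K x * (\<omega> x vs)\<^sup>2 = 0"
      using integral_nonneg_eq_0_iff_AE[OF int2] by simp
    then show ?thesis
    proof (rule AE_mp, intro AE_I2 impI)
      fix x assume "x \<in> space (lebesgue_on \<Omega>)" "?K x * (\<omega> x vs)\<^sup>2 = 0" "x \<in> K"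
      then show "\<omega> x vs = 0"
        by (simp add: indicator_def)
    qed
  qed
  moreover have "finite (\<T> \<times> ?I)"
    by (intro finite_cartesian_product finite_basis_lists)
      (use mesh in \<open>simp add: triangulation_of_def triangulation_def\<close>)
  \<comment> \<open>There are finitely many pairs of a simplex and a basis list, so one null set
    works for all of them; since the simplices cover the domain, all components vanish outside
    it.\<close>
  ultimately have "AE x in lebesgue_on \<Omega>. \<forall>(K, vs)\<in>\<T> \<times> ?I. x \<in> K \<longrightarrow> \<omega> x vs = 0"
    by (intro AE_finite_allI) auto
  then have "AE x in lebesgue_on \<Omega>. alt_inner j (\<omega> x) (\<omega> x) = 0"
  proof (rule AE_mp, intro AE_I2 impI)
    fix x assume x: "x \<in> space (lebesgue_on \<Omega>)" and 0: "\<forall>(K, vs)\<in>\<T> \<times> ?I. x \<in> K \<longrightarrow> \<omega> x vs = 0"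
    have "x \<in> \<Union>\<T>"
      using mesh x closure_subset[of \<Omega>] by (auto simp: triangulation_of_def)
    then have "\<forall>vs\<in>?I. \<omega> x vs = 0"
      using 0 by blast
    then show "alt_inner j (\<omega> x) (\<omega> x) = 0"
      by (simp add: alt_inner_def)
  qed
  then show ?thesis
    unfolding form_inner_def by (rule integral_eq_zero_AE)
qed

text \<open>Makes the functional taking v to the pairing of its exterior derivative with a fixed
  form well defined modulo null forms, as the Riesz argument demands.\<close>

lemma ext_deriv_null:
  assumes \<Omega>: "open \<Omega>" "bounded \<Omega>" and \<omega>: "\<omega> \<in> H_forms \<Omega> j" "form_inner \<Omega> j \<omega> \<omega> = 0"
    and \<theta>: "\<theta> \<in> L2_forms \<Omega> (j + 1)"
  shows "form_inner \<Omega> (j + 1) (ext_deriv \<Omega> j \<omega>) \<theta> = 0"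
proof -
  have "AE x in lebesgue_on \<Omega>. ext_deriv \<Omega> j \<omega> x vs = 0" for vs
    by (rule AE_eq_0_if_weak_ext_deriv_0[OF \<Omega> H_forms_ext_deriv[OF \<omega>(1)] H_forms_L2[OF \<omega>(1)]
          AE_eq_0_if_form_inner_self_eq_0[OF H_forms_L2[OF \<omega>(1)] \<omega>(2)]])
  then have "form_inner \<Omega> (j + 1) (ext_deriv \<Omega> j \<omega>) \<theta> = form_inner \<Omega> (j + 1) (\<lambda>x vs. 0) \<theta>"
    by (rule form_inner_cong_AE[OF H_forms_ext_deriv(1)[OF \<omega>(1)] zero_in_L2_forms \<theta>])
  then show ?thesis
    by (simp add: form_inner_zero)
qed

lemma discrete_coderiv_exists:
  fixes \<Omega> :: "'a::euclidean_space set"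
  assumes \<Omega>: "open \<Omega>" "bounded \<Omega>" and mesh: "triangulation_of \<T> \<Omega>"
    and \<omega>: "\<omega> \<in> L2_forms \<Omega> (j + 1)" and nonempty: "fe_space \<Omega> \<T> fam j \<noteq> {}"
  shows "\<exists>\<tau>\<in>fe_space \<Omega> \<T> fam j. \<forall>v\<in>fe_space \<Omega> \<T> fam j.
           form_inner \<Omega> j \<tau> v = form_inner \<Omega> (j + 1) (ext_deriv \<Omega> j v) \<omega>"
proof -
  let ?W = "fe_space \<Omega> \<T> fam j"
  obtain G :: "('a \<Rightarrow> real) set" where G: "finite G" "\<And>g. g \<in> G \<Longrightarrow> continuous_on UNIV g"
    "\<And>p vs. p \<in> shape_forms fam j \<Longrightarrow> (\<lambda>x. p x vs) \<in> fun_span G"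
    using shape_forms_finite_span[of fam j] by metis
  let ?I = "{vs :: 'a list. set vs \<subseteq> Basis \<and> int (length vs) = j}"
  \<comment> \<open>Moments of one component over one simplex against one generator: the finitely
    many functionals that separate the space modulo null forms.\<close>
  define \<phi> where "\<phi> = (\<lambda>(K, vs, g) (v :: 'a form).
    LINT x|lebesgue_on \<Omega>. indicat_real (K \<inter> \<Omega>) x * (v x vs * g x))"
  show ?thesis
  proof (rule Riesz_finite_rank[where comb = lin_comb and \<phi> = \<phi> and I = "\<T> \<times> ?I \<times> G"])
    show "finite (\<T> \<times> ?I \<times> G)"
      by (intro finite_cartesian_product finite_basis_lists G(1))
        (use mesh in \<open>simp add: triangulation_of_def triangulation_def\<close>)
    show "form_inner \<Omega> j v w = 0" if "v \<in> ?W" "w \<in> ?W" "form_inner \<Omega> j v v = 0" for v w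
      using form_inner_Cauchy_Schwarz[OF fe_space_L2[OF that(1)] fe_space_L2[OF that(2)]] that(3)
      by (simp add: form_norm_def)
    show "form_inner \<Omega> (j + 1) (ext_deriv \<Omega> j (lin_comb a v b w)) \<omega> =
        a * form_inner \<Omega> (j + 1) (ext_deriv \<Omega> j v) \<omega> + b * form_inner \<Omega> (j + 1) (ext_deriv \<Omega> j w) \<omega>"
      if "v \<in> ?W" "w \<in> ?W" for a v b w
      using that by (intro form_inner_ext_deriv_lin_comb \<Omega> \<omega> fe_space_H)
    show "form_inner \<Omega> (j + 1) (ext_deriv \<Omega> j v) \<omega> = 0" if "v \<in> ?W" "form_inner \<Omega> j v v = 0" for v
      using that by (intro ext_deriv_null \<Omega> \<omega> fe_space_H)
    show "form_inner \<Omega> j v v = 0" if "v \<in> ?W" "\<And>i. i \<in> \<T> \<times> ?I \<times> G \<Longrightarrow> \<phi> i v = 0" for v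
    proof (rule fe_space_null_if_moments_0[where G = G and fam = fam, OF \<Omega> mesh _ _ that(1)])
      show "(LINT x|lebesgue_on \<Omega>. indicator (K \<inter> \<Omega>) x * (v x vs * g x)) = 0"
        if "K \<in> \<T>" "set vs \<subseteq> Basis" "int (length vs) = j" "g \<in> G" for K vs g
        using \<open>\<And>i. i \<in> \<T> \<times> ?I \<times> G \<Longrightarrow> \<phi> i v = 0\<close>[of "(K, vs, g)"] that by (simp add: \<phi>_def)
    qed (use G in auto)
    show "\<phi> i (lin_comb a v b w) = a * \<phi> i v + b * \<phi> i w"
      if "i \<in> \<T> \<times> ?I \<times> G" "v \<in> ?W" "w \<in> ?W" for i a v b w
    proof -
      from that(1) obtain K vs g where i: "i = (K, vs, g)" "K \<in> \<T>" "g \<in> G"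
        by auto
      have K_sets: "K \<inter> \<Omega> \<in> sets (lebesgue_on \<Omega>)"
        using triangulation_of_closed[OF mesh i(2)] \<Omega> by (simp add: sets_restrict_space_iff)
      have int: "integrable (lebesgue_on \<Omega>) (\<lambda>x. indicat_real (K \<inter> \<Omega>) x * (u x vs * g x))"
        if "u \<in> ?W" for u
        using integrable_mult_indicator[OF K_sets
            integrable_L2_times_continuous[OF \<Omega> fe_space_L2[OF that] G(2)[OF i(3)], of vs]]
        by simp
      have "\<phi> i (lin_comb a v b w) = (LINT x|lebesgue_on \<Omega>.
          a * (indicat_real (K \<inter> \<Omega>) x * (v x vs * g x)) + b * (indicat_real (K \<inter> \<Omega>) x * (w x vs * g x)))"
        by (simp add: \<phi>_def i(1) lin_comb_def algebra_simps)
      also have "\<dots> = a * \<phi> i v + b * \<phi> i w"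
        using int that(2,3) by (simp add: \<phi>_def i(1))
      finally show ?thesis .
    qed
  qed (use nonempty in \<open>auto simp: fe_space_lin_comb \<Omega> form_inner_lin_comb_left fe_space_L2 intro: form_inner_commute\<close>)
qed

text \<open>Justifies the choice in \<open>discrete_coderiv\<close>. The test function v also
  witnesses that the space is nonempty, which the existence lemma asks for.\<close>

lemma form_inner_discrete_coderiv:
  assumes "open \<Omega>" "bounded \<Omega>" "triangulation_of \<T> \<Omega>"
    and "\<omega> \<in> L2_forms \<Omega> j" "v \<in> fe_space \<Omega> \<T> fam (j - 1)"
  shows "discrete_coderiv \<Omega> \<T> fam j \<omega> \<in> fe_space \<Omega> \<T> fam (j - 1)"
    and "form_inner \<Omega> (j - 1) (discrete_coderiv \<Omega> \<T> fam j \<omega>) v = form_inner \<Omega> j \<omega> (ext_deriv \<Omega> (j - 1) v)"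
proof -
  let ?W = "fe_space \<Omega> \<T> fam (j - 1)"
  have "\<exists>\<tau>. \<tau> \<in> ?W \<and> (\<forall>v\<in>?W. form_inner \<Omega> (j - 1) \<tau> v = form_inner \<Omega> j \<omega> (ext_deriv \<Omega> (j - 1) v))"
    using discrete_coderiv_exists[of \<Omega> \<T> \<omega> "j - 1" fam] assms
    by (auto simp: form_inner_commute[of \<Omega> j \<omega>])
  from someI_ex[OF this]
  show "discrete_coderiv \<Omega> \<T> fam j \<omega> \<in> ?W"
    "form_inner \<Omega> (j - 1) (discrete_coderiv \<Omega> \<T> fam j \<omega>) v = form_inner \<Omega> j \<omega> (ext_deriv \<Omega> (j - 1) v)"
    using assms(5) by (auto simp: discrete_coderiv_def)
qed

section \<open>The mixed system\<close>

definition lin_comb3 :: "real \<Rightarrow> 'a form3 \<Rightarrow> real \<Rightarrow> 'a form3 \<Rightarrow> 'a form3" where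
  "lin_comb3 a X b Y = (lin_comb a (fst X) b (fst Y),
     lin_comb a (fst (snd X)) b (fst (snd Y)), lin_comb a (snd (snd X)) b (snd (snd Y)))"

lemma inner3_eq:
  "inner3 \<Omega> k X Y = form_inner \<Omega> (k - 1) (fst X) (fst Y) +
     form_inner \<Omega> k (fst (snd X)) (fst (snd Y)) + form_inner \<Omega> (k + 1) (snd (snd X)) (snd (snd Y))"
  by (simp add: inner3_def case_prod_beta)

lemma fe_space3_iff:
  "X \<in> fe_space3 \<Omega> \<T> fam k \<longleftrightarrow> fst X \<in> fe_space \<Omega> \<T> fam (k - 1) \<and>
     fst (snd X) \<in> fe_space \<Omega> \<T> fam k \<and> snd (snd X) \<in> fe_space \<Omega> \<T> fam (k + 1)"
  by (auto simp: fe_space3_def mem_Times_iff)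

lemma inner3_commute: "inner3 \<Omega> k X Y = inner3 \<Omega> k Y X"
  by (simp add: inner3_eq form_inner_commute)

lemma norm3_square: "(norm3 \<Omega> k X)\<^sup>2 = inner3 \<Omega> k X X"
  by (simp add: norm3_def inner3_eq form_inner_self_nonneg)

lemma norm3_nonneg: "0 \<le> norm3 \<Omega> k X"
  by (simp add: norm3_def inner3_eq form_inner_self_nonneg)

lemma form_norm_le_norm3: "form_norm \<Omega> k (fst (snd X)) \<le> norm3 \<Omega> k X"
  by (simp add: form_norm_def norm3_def inner3_eq form_inner_self_nonneg)

lemma fe_space3_lin_comb3:
  assumes "open \<Omega>" "bounded \<Omega>" "X \<in> fe_space3 \<Omega> \<T> fam k" "Y \<in> fe_space3 \<Omega> \<T> fam k"
  shows "lin_comb3 a X b Y \<in> fe_space3 \<Omega> \<T> fam k"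
  using assms by (simp add: fe_space3_iff lin_comb3_def fe_space_lin_comb)

lemma inner3_lin_comb3_left:
  assumes "X \<in> fe_space3 \<Omega> \<T> fam k" "Y \<in> fe_space3 \<Omega> \<T> fam k" "Z \<in> fe_space3 \<Omega> \<T> fam k"
  shows "inner3 \<Omega> k (lin_comb3 a X b Y) Z = a * inner3 \<Omega> k X Z + b * inner3 \<Omega> k Y Z"
proof -
  note L2 = fe_space_L2[of _ \<Omega> \<T> fam]
  show ?thesis
    using assms by (simp add: fe_space3_iff inner3_eq lin_comb3_def form_inner_lin_comb_left L2 algebra_simps)
qed

lemma inner3_lin_comb3_right:
  assumes "X \<in> fe_space3 \<Omega> \<T> fam k" "Y \<in> fe_space3 \<Omega> \<T> fam k" "Z \<in> fe_space3 \<Omega> \<T> fam k"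
  shows "inner3 \<Omega> k Z (lin_comb3 a X b Y) = a * inner3 \<Omega> k Z X + b * inner3 \<Omega> k Z Y"
  using inner3_lin_comb3_left[OF assms] by (simp add: inner3_commute)

context
  fixes \<Omega> :: "'a::euclidean_space set" and \<T> :: "'a set set" and fam :: fe_family and k :: int
  assumes \<Omega>: "open \<Omega>" "bounded \<Omega>" and mesh: "triangulation_of \<T> \<Omega>"
begin

text \<open>Moving the coderivatives onto the test function leaves only exterior derivatives. The
  right-hand side changes sign when X and Y are exchanged, so skewness can be read off, and
  linearity in X reduces to that of \<open>ext_deriv\<close> under the inner product.\<close>

lemma inner3_A_h:
  assumes X: "X \<in> fe_space3 \<Omega> \<T> fam k" and Y: "Y \<in> fe_space3 \<Omega> \<T> fam k"
  shows "inner3 \<Omega> k (A_h \<Omega> \<T> fam k X) Y =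
    form_inner \<Omega> k (ext_deriv \<Omega> (k - 1) (fst X)) (fst (snd Y))
      - form_inner \<Omega> k (ext_deriv \<Omega> (k - 1) (fst Y)) (fst (snd X))
    + form_inner \<Omega> (k + 1) (ext_deriv \<Omega> k (fst (snd Y))) (snd (snd X))
      - form_inner \<Omega> (k + 1) (ext_deriv \<Omega> k (fst (snd X))) (snd (snd Y))"
proof -
  obtain \<sigma> \<mu> \<omega> where X_eq: "X = (\<sigma>, \<mu>, \<omega>)" by (metis prod_cases3)
  obtain \<sigma>' \<mu>' \<omega>' where Y_eq: "Y = (\<sigma>', \<mu>', \<omega>')" by (metis prod_cases3)
  let ?V = "fe_space \<Omega> \<T> fam"
  have mem: "\<sigma> \<in> ?V (k - 1)" "\<mu> \<in> ?V k" "\<omega> \<in> ?V (k + 1)" "\<sigma>' \<in> ?V (k - 1)" "\<mu>' \<in> ?V k" "\<omega>' \<in> ?V (k + 1)"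
    using X Y by (simp_all add: fe_space3_iff X_eq Y_eq)
  note L2 = mem[THEN fe_space_L2]
  let ?\<delta> = "discrete_coderiv \<Omega> \<T> fam k \<mu>" and ?\<delta>' = "discrete_coderiv \<Omega> \<T> fam (k + 1) \<omega>"
  have \<delta>: "?\<delta> \<in> L2_forms \<Omega> (k - 1)" "form_inner \<Omega> (k - 1) ?\<delta> \<sigma>' = form_inner \<Omega> k \<mu> (ext_deriv \<Omega> (k - 1) \<sigma>')"
    using form_inner_discrete_coderiv[OF \<Omega> mesh L2(2) mem(4)] by (auto intro: fe_space_L2)
  have \<delta>': "?\<delta>' \<in> L2_forms \<Omega> k" "form_inner \<Omega> k ?\<delta>' \<mu>' = form_inner \<Omega> (k + 1) \<omega> (ext_deriv \<Omega> k \<mu>')"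
    using form_inner_discrete_coderiv[OF \<Omega> mesh L2(3), of \<mu>' fam] mem(5) by (auto intro: fe_space_L2)
  have d: "ext_deriv \<Omega> (k - 1) \<sigma> \<in> L2_forms \<Omega> k" "ext_deriv \<Omega> k \<mu> \<in> L2_forms \<Omega> (k + 1)"
    using H_forms_ext_deriv(1)[OF fe_space_H[OF mem(1)]] H_forms_ext_deriv(1)[OF fe_space_H[OF mem(2)]]
    by simp_all
  \<comment> \<open>Negatives are written as combinations whose second coefficient is 0, so that the
    rules for \<open>lin_comb\<close> cover all three components.\<close>
  have "A_h \<Omega> \<T> fam k X = (lin_comb (-1) ?\<delta> 0 ?\<delta>, lin_comb 1 (ext_deriv \<Omega> (k - 1) \<sigma>) 1 ?\<delta>',
      lin_comb (-1) (ext_deriv \<Omega> k \<mu>) 0 (ext_deriv \<Omega> k \<mu>))"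
    by (simp add: A_h_def X_eq lin_comb_def)
  then show ?thesis
    using \<delta> \<delta>' d L2
    by (simp add: inner3_eq X_eq Y_eq form_inner_lin_comb_left form_inner_commute[of \<Omega> k \<mu>]
        form_inner_commute[of \<Omega> "k + 1" \<omega>])
qed

lemma inner3_A_h_self:
  "X \<in> fe_space3 \<Omega> \<T> fam k \<Longrightarrow> inner3 \<Omega> k (A_h \<Omega> \<T> fam k X) X = 0"
  by (simp add: inner3_A_h)

lemma inner3_A_h_lin_comb3:
  assumes X: "X \<in> fe_space3 \<Omega> \<T> fam k" and Y: "Y \<in> fe_space3 \<Omega> \<T> fam k" and Z: "Z \<in> fe_space3 \<Omega> \<T> fam k"
  shows "inner3 \<Omega> k (A_h \<Omega> \<T> fam k (lin_comb3 a X b Y)) Z =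
    a * inner3 \<Omega> k (A_h \<Omega> \<T> fam k X) Z + b * inner3 \<Omega> k (A_h \<Omega> \<T> fam k Y) Z"
proof -
  let ?V = "fe_space \<Omega> \<T> fam"
  have lin: "form_inner \<Omega> l (ext_deriv \<Omega> (l - 1) (lin_comb a \<omega> b \<eta>)) \<theta> =
      a * form_inner \<Omega> l (ext_deriv \<Omega> (l - 1) \<omega>) \<theta> + b * form_inner \<Omega> l (ext_deriv \<Omega> (l - 1) \<eta>) \<theta>"
    if "\<omega> \<in> ?V (l - 1)" "\<eta> \<in> ?V (l - 1)" "\<theta> \<in> ?V l" for l \<omega> \<eta> \<theta>
    using form_inner_ext_deriv_lin_comb[OF \<Omega> fe_space_H[OF that(1)] fe_space_H[OF that(2)]]
      fe_space_L2[OF that(3)] by simp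
  have lin': "form_inner \<Omega> l (ext_deriv \<Omega> (l - 1) \<theta>) (lin_comb a \<omega> b \<eta>) =
      a * form_inner \<Omega> l (ext_deriv \<Omega> (l - 1) \<theta>) \<omega> + b * form_inner \<Omega> l (ext_deriv \<Omega> (l - 1) \<theta>) \<eta>"
    if "\<omega> \<in> ?V l" "\<eta> \<in> ?V l" "\<theta> \<in> ?V (l - 1)" for l \<omega> \<eta> \<theta>
    using form_inner_lin_comb_right[OF fe_space_L2[OF that(1)] fe_space_L2[OF that(2)]]
      H_forms_ext_deriv(1)[OF fe_space_H[OF that(3)]] by simp
  show ?thesis
    using X Y Z lin[of _ k] lin[of _ "k + 1"] lin'[of _ k] lin'[of _ "k + 1"]
    by (simp add: inner3_A_h fe_space3_lin_comb3 \<Omega>)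
       (simp add: fe_space3_iff lin_comb3_def algebra_simps)
qed

end

section \<open>Time stepping\<close>

text \<open>The coefficients a and b of an affine piece are not known to lie in the finite element
  space, but the values at the two ends are; hence the change to end values. The derivative is
  claimed only inside the interval, since the slope may jump at a node.\<close>

lemma affine_form_interpolation:
  fixes u :: "real \<Rightarrow> 'a form"
  assumes u: "\<forall>t\<in>{s..e}. u t = (\<lambda>x vs. a x vs + t * b x vs)" and "s < e"
  shows "t \<in> {s..e} \<Longrightarrow> u t = lin_comb ((e - t) / (e - s)) (u s) ((t - s) / (e - s)) (u e)"
    and "t \<in> {s<..<e} \<Longrightarrow> form_time_deriv u t = lin_comb (- 1 / (e - s)) (u s) (1 / (e - s)) (u e)"
proof -
  assume t: "t \<in> {s..e}"
  have "a x vs + t * b x vs =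
      (e - t) / (e - s) * (a x vs + s * b x vs) + (t - s) / (e - s) * (a x vs + e * b x vs)" for x vs
  proof -
    have "(e - t) / (e - s) * (a x vs + s * b x vs) + (t - s) / (e - s) * (a x vs + e * b x vs) =
        ((e - s) * (a x vs + t * b x vs)) / (e - s)"
      by (simp add: add_divide_distrib[symmetric] algebra_simps)
    then show ?thesis
      using \<open>s < e\<close> by simp
  qed
  then show "u t = lin_comb ((e - t) / (e - s)) (u s) ((t - s) / (e - s)) (u e)"
    using u t \<open>s < e\<close> by (simp add: lin_comb_def)
next
  assume t: "t \<in> {s<..<e}"
  have "deriv (\<lambda>\<tau>. u \<tau> x vs) t = b x vs" for x vs
  proof (rule DERIV_imp_deriv)
    have "((\<lambda>\<tau>. a x vs + \<tau> * b x vs) has_real_derivative b x vs) (at t)"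
      by (auto intro!: derivative_eq_intros)
    then show "((\<lambda>\<tau>. u \<tau> x vs) has_real_derivative b x vs) (at t)"
      by (rule has_field_derivative_transform_within_open[where S = "{s<..<e}"]) (use t u in auto)
  qed
  moreover have "b x vs = - 1 / (e - s) * (a x vs + s * b x vs) + 1 / (e - s) * (a x vs + e * b x vs)" for x vs
  proof -
    have "- 1 / (e - s) * (a x vs + s * b x vs) + 1 / (e - s) * (a x vs + e * b x vs) =
        ((e - s) * b x vs) / (e - s)"
      by (simp add: add_divide_distrib[symmetric] diff_divide_distrib[symmetric] algebra_simps)
    then show ?thesis
      using \<open>s < e\<close> by simp
  qed
  ultimately show "form_time_deriv u t = lin_comb (- 1 / (e - s)) (u s) (1 / (e - s)) (u e)"
    using u \<open>s < e\<close> by (simp add: form_time_deriv_def lin_comb_def)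
qed

lemma P1_time_interpolation:
  assumes U: "U \<in> P1_time T N W" and i: "i \<in> {1..N}" and "T > 0"
  defines "s \<equiv> time_node T N (i - 1)" and "e \<equiv> time_node T N i"
  shows "t \<in> {s..e} \<Longrightarrow> U t = lin_comb3 ((e - t) / (e - s)) (U s) ((t - s) / (e - s)) (U e)"
    and "t \<in> {s<..<e} \<Longrightarrow> time_deriv3 U t = lin_comb3 (- 1 / (e - s)) (U s) (1 / (e - s)) (U e)"
proof -
  have "s < e"
    using i \<open>T > 0\<close> by (simp add: s_def e_def time_node_def divide_strict_right_mono)
  have pw: "pw_linear T N (\<lambda>t. fst (U t))" "pw_linear T N (\<lambda>t. fst (snd (U t)))"
    "pw_linear T N (\<lambda>t. snd (snd (U t)))"
    using U by (auto simp: P1_time_def)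
  obtain a1 b1 where 1: "\<forall>t\<in>{s..e}. fst (U t) = (\<lambda>x vs. a1 x vs + t * b1 x vs)"
    using pw(1) i unfolding pw_linear_def s_def e_def by blast
  obtain a2 b2 where 2: "\<forall>t\<in>{s..e}. fst (snd (U t)) = (\<lambda>x vs. a2 x vs + t * b2 x vs)"
    using pw(2) i unfolding pw_linear_def s_def e_def by blast
  obtain a3 b3 where 3: "\<forall>t\<in>{s..e}. snd (snd (U t)) = (\<lambda>x vs. a3 x vs + t * b3 x vs)"
    using pw(3) i unfolding pw_linear_def s_def e_def by blast
  note interp = affine_form_interpolation[OF 1 \<open>s < e\<close>] affine_form_interpolation[OF 2 \<open>s < e\<close>]
    affine_form_interpolation[OF 3 \<open>s < e\<close>]
  show "U t = lin_comb3 ((e - t) / (e - s)) (U s) ((t - s) / (e - s)) (U e)" if "t \<in> {s..e}"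
    unfolding lin_comb3_def
    using interp(1)[OF that] interp(3)[OF that] interp(5)[OF that] by (metis prod.collapse)
  show "time_deriv3 U t = lin_comb3 (- 1 / (e - s)) (U s) (1 / (e - s)) (U e)" if "t \<in> {s<..<e}"
    unfolding lin_comb3_def time_deriv3_def
    using interp(2)[OF that] interp(4)[OF that] interp(6)[OF that] by simp
qed

text \<open>The factor e + s - 2 t is odd about the midpoint of the interval, so only the constant
  survives. In the energy balance the odd part is the contribution of \<open>A_h\<close>.\<close>

lemma set_integral_affine_symmetric:
  fixes c d s e :: real
  assumes "s < e"
  shows "(LINT t:{s<..<e}|lebesgue. c + (e + s - 2 * t) * d) = (e - s) * c"
proof -
  let ?f = "\<lambda>t. c + (e + s - 2 * t) * d"
  have "set_integrable lebesgue {s..e} ?f"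
    by (intro absolutely_integrable_continuous_real continuous_intros)
  then have "set_integrable lebesgue {s<..<e} ?f"
    by (rule set_integrable_subset) auto
  then have "(LINT t:{s<..<e}|lebesgue. ?f t) = integral {s<..<e} ?f"
    by (rule set_lebesgue_integral_eq_integral(2))
  also have "\<dots> = integral {s..e} ?f"
    using integral_open_interval[of s e ?f] by (simp add: box_real)
  also have "(?f has_integral (c * e + (e + s) * d * e - d * e\<^sup>2) - (c * s + (e + s) * d * s - d * s\<^sup>2)) {s..e}"
    using assms
    by (intro fundamental_theorem_of_calculus[where f = "\<lambda>t. c * t + (e + s) * d * t - d * t\<^sup>2"])
       (auto simp: has_real_derivative_iff_has_vector_derivative[symmetric] algebra_simps
         intro!: derivative_eq_intros)
  then have "integral {s..e} ?f = (c * e + (e + s) * d * e - d * e\<^sup>2) - (c * s + (e + s) * d * s - d * s\<^sup>2)"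
    by (rule integral_unique)
  also have "\<dots> = (e - s) * c"
    by (simp add: power2_eq_square algebra_simps)
  finally show ?thesis .
qed

text \<open>Measurability of the norm in time comes from the approximating simple functions; the
  essential bound then gives integrability on the finite interval.\<close>

lemma Linfty_L2_norm_integrable:
  assumes f: "f \<in> Linfty_L2 T \<Omega> j"
  shows "set_integrable lebesgue {0..T} (\<lambda>t. form_norm \<Omega> j (f t))"
proof -
  let ?M = "lebesgue_on {0<..<T}" and ?n = "form_norm \<Omega> j"
  have L2: "AE t in ?M. f t \<in> L2_forms \<Omega> j"
    using f unfolding Linfty_L2_def by (elim CollectE conjE)
  have "\<exists>C. AE t in ?M. ?n (f t) \<le> C"
    using f unfolding Linfty_L2_def by (elim CollectE conjE)
  then obtain C where C: "AE t in ?M. ?n (f t) \<le> C" ..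
  have "\<exists>s. (\<forall>m. simple_function ?M (s m) \<and> s m ` {0<..<T} \<subseteq> L2_forms \<Omega> j) \<and>
      (AE t in ?M. (\<lambda>m. ?n (\<lambda>x vs. s m t x vs - f t x vs)) \<longlonglongrightarrow> 0)"
    using f unfolding Linfty_L2_def by (elim CollectE conjE)
  then obtain s where s_all: "\<forall>m. simple_function ?M (s m) \<and> s m ` {0<..<T} \<subseteq> L2_forms \<Omega> j"
    and lim: "AE t in ?M. (\<lambda>m. ?n (\<lambda>x vs. s m t x vs - f t x vs)) \<longlonglongrightarrow> 0"
    by (elim exE conjE)
  have s: "simple_function ?M (s m)" "s m ` {0<..<T} \<subseteq> L2_forms \<Omega> j" for m
    by (rule s_all[THEN spec, THEN conjunct1], rule s_all[THEN spec, THEN conjunct2])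
  \<comment> \<open>As \<open>lim\<close> is total, this is a measurable function on the whole
    interval; it is compared with the norm of f only where the approximations converge.\<close>
  define \<phi> where "\<phi> t = lim (\<lambda>m. ?n (s m t))" for t
  have \<phi>_meas: "\<phi> \<in> borel_measurable ?M"
    unfolding \<phi>_def
    by (rule borel_measurable_lim_metric, rule borel_measurable_simple_function,
        rule simple_function_compose1[OF s(1)])
  have \<phi>_eq: "AE t in ?M. ?n (f t) = \<phi> t"
    using lim L2 AE_space
  proof eventually_elim
    case (elim t)
    \<comment> \<open>Reverse triangle inequality, with each of the two forms written as a
      combination of the other one and their difference.\<close>
    have "\<bar>?n (s m t) - ?n (f t)\<bar> \<le> ?n (\<lambda>x vs. s m t x vs - f t x vs)" for m
    proof -
      let ?d = "lin_comb 1 (s m t) (-1) (f t)"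
      have sm: "s m t \<in> L2_forms \<Omega> j"
        using s(2)[of m] elim(3) by auto
      have d: "?d \<in> L2_forms \<Omega> j"
        by (rule L2_forms_lin_comb[OF sm elim(2)])
      have "?n (lin_comb 1 ?d 1 (f t)) \<le> ?n ?d + ?n (f t)"
        using form_norm_lin_comb_le[OF d elim(2), of 1 1] by simp
      moreover have "lin_comb 1 ?d 1 (f t) = s m t"
        by (simp add: lin_comb_def)
      moreover have "?n (lin_comb 1 (s m t) (-1) ?d) \<le> ?n (s m t) + ?n ?d"
        using form_norm_lin_comb_le[OF sm d, of 1 "-1"] by simp
      moreover have "lin_comb 1 (s m t) (-1) ?d = f t"
        by (simp add: lin_comb_def)
      moreover have "?d = (\<lambda>x vs. s m t x vs - f t x vs)"
        by (simp add: lin_comb_def)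
      ultimately show ?thesis
        by (simp add: abs_le_iff)
    qed
    then have "(\<lambda>m. ?n (s m t) - ?n (f t)) \<longlonglongrightarrow> 0"
      by (intro tendsto_rabs_zero_cancel[OF tendsto_sandwich[OF _ _ tendsto_const elim(1)]]) auto
    then have "(\<lambda>m. ?n (s m t)) \<longlonglongrightarrow> ?n (f t)"
      by (rule LIM_zero_cancel)
    then show ?case
      by (simp add: \<phi>_def limI)
  qed
  interpret finite_measure ?M
    by (intro finite_measure_lebesgue_on) simp
  have "AE t in ?M. norm (\<phi> t) \<le> C"
    using \<phi>_eq C
  proof eventually_elim
    case (elim t)
    then show ?case
      using form_norm_nonneg[of \<Omega> j "f t"] by simp
  qed
  then have "integrable ?M \<phi>"
    using \<phi>_meas by (intro integrable_const_bound[where B = C])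
  then have \<phi>_int: "\<phi> absolutely_integrable_on {0<..<T}"
    by (simp add: set_integrable_def integrable_restrict_space)
  have "AE t in lebesgue. t \<in> {0<..<T} \<longrightarrow> ?n (f t) = \<phi> t"
    using \<phi>_eq by (simp add: AE_restrict_space_iff)
  then obtain Z where Z: "{t. \<not> (t \<in> {0<..<T} \<longrightarrow> ?n (f t) = \<phi> t)} \<subseteq> Z" "Z \<in> null_sets lebesgue"
    by (auto simp: eventually_ae_filter)
  have "(\<lambda>t. ?n (f t)) absolutely_integrable_on {0<..<T}"
    by (rule absolutely_integrable_spike[OF \<phi>_int, of Z])
       (use Z in \<open>auto simp: negligible_iff_null_sets\<close>)
  \<comment> \<open>The values of f at times 0 and T are unconstrained, but these two points form a
    null set.\<close>
  moreover have "(\<lambda>t. ?n (f t)) absolutely_integrable_on {0<..<T} \<longleftrightarrow>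
      (\<lambda>t. ?n (f t)) absolutely_integrable_on {0..T}"
  proof (rule absolutely_integrable_spike_set_eq)
    show "negligible {t \<in> {0..T} - {0<..<T}. ?n (f t) \<noteq> 0}"
      by (rule negligible_subset[of "{0, T}"]) auto
    show "negligible {t \<in> {0<..<T} - {0..T}. ?n (f t) \<noteq> 0}"
      by (rule negligible_subset[of "{}"]) auto
  qed
  ultimately show ?thesis
    by blast
qed

section \<open>Energy balance on one time interval\<close>

lemma inner3_source3: "inner3 \<Omega> k (source3 f t) V = form_inner \<Omega> k (f t) (fst (snd V))"
  by (simp add: inner3_eq source3_def form_inner_zero)

lemma norm3_source3: "norm3 \<Omega> k (source3 f t) = form_norm \<Omega> k (f t)"
  by (simp add: norm3_def form_norm_def inner3_source3) (simp add: source3_def)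

lemma time_node_mono: "T > 0 \<Longrightarrow> i \<le> j \<Longrightarrow> time_node T N i \<le> time_node T N j"
  by (simp add: time_node_def divide_right_mono)

lemma energy_identity:
  assumes \<Omega>: "open \<Omega>" "bounded \<Omega>" and mesh: "triangulation_of \<T> \<Omega>"
    and T: "T > 0" and sol: "fully_discrete_solution T N \<Omega> \<T> fam k (source3 f) U0 U"
    and i: "i \<in> {1..N}"
  defines "s \<equiv> time_node T N (i - 1)" and "e \<equiv> time_node T N i"
  shows "((norm3 \<Omega> k (U e))\<^sup>2 - (norm3 \<Omega> k (U s))\<^sup>2) / 2 =
    (LINT t:{s<..<e}|lebesgue. form_inner \<Omega> k (f t) (lin_comb (1 / 2) (fst (snd (U s))) (1 / 2) (fst (snd (U e)))))"
proof -
  let ?W = "fe_space3 \<Omega> \<T> fam k"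
  define M where "M = lin_comb3 (1 / 2) (U s) (1 / 2) (U e)"
  \<comment> \<open>The zero triple, written as a combination so that its membership follows from
    closure of the finite element space.\<close>
  define Z where "Z = lin_comb3 0 (U s) 0 (U s)"
  define V where "V t = (if t \<in> {s<..<e} then M else Z)" for t
  have U: "U \<in> P1_time T N ?W"
    and eq: "\<And>V. V \<in> P0_time T N ?W \<Longrightarrow>
        (LINT t:{0..T}|lebesgue. inner3 \<Omega> k (time_deriv3 U t) (V t) + inner3 \<Omega> k (A_h \<Omega> \<T> fam k (U t)) (V t)) =
        (LINT t:{0..T}|lebesgue. inner3 \<Omega> k (source3 f t) (V t))"
    using sol by (auto simp: fully_discrete_solution_def)
  have "s < e"
    using i T by (simp add: s_def e_def time_node_def divide_strict_right_mono)
  have "0 \<le> s"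
    using T by (simp add: s_def time_node_def)
  have "e \<le> T"
    using time_node_mono[OF T, of i N N] i by (simp add: e_def time_node_def)
  have P: "U s \<in> ?W" and Q: "U e \<in> ?W"
    using U \<open>0 \<le> s\<close> \<open>s < e\<close> \<open>e \<le> T\<close> by (auto simp: P1_time_def)
  have M: "M \<in> ?W" and Z: "Z \<in> ?W"
    unfolding M_def Z_def by (rule fe_space3_lin_comb3[OF \<Omega> P Q] fe_space3_lin_comb3[OF \<Omega> P P])+
  \<comment> \<open>Every component of Z is literally 0, so this holds also for triples that are not
    square integrable, such as the source at exceptional times.\<close>
  have Z0: "inner3 \<Omega> k X Z = 0" for X
    by (simp add: Z_def inner3_eq lin_comb3_def lin_comb_def form_inner_zero)
  have "V \<in> P0_time T N ?W"
  proof -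
    have "\<exists>c. \<forall>t\<in>{time_node T N (j - 1)<..<time_node T N j}. V t = c" if j: "j \<in> {1..N}" for j
    proof (cases "j = i")
      case True
      then show ?thesis
        by (intro exI[of _ M]) (simp add: V_def s_def e_def)
    next
      case False
      then consider "j \<le> i - 1" | "i \<le> j - 1"
        using i j by fastforce
      then have "time_node T N j \<le> s \<or> e \<le> time_node T N (j - 1)"
        using time_node_mono[OF T] by cases (auto simp: s_def e_def)
      then show ?thesis
        by (intro exI[of _ Z]) (auto simp: V_def)
    qed
    then show ?thesis
      using M Z by (simp add: P0_time_def V_def)
  qed
  note test = eq[OF this]
  define p where "p = inner3 \<Omega> k (A_h \<Omega> \<T> fam k (U s)) M"
  define q where "q = inner3 \<Omega> k (A_h \<Omega> \<T> fam k (U e)) M"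
  \<comment> \<open>The value of the pairing of the difference quotient of U with the midpoint M; it
    is constant in time because the mixed products cancel by symmetry.\<close>
  define c where "c = ((norm3 \<Omega> k (U e))\<^sup>2 - (norm3 \<Omega> k (U s))\<^sup>2) / (2 * (e - s))"
  \<comment> \<open>Skewness at M, expanded by linearity, forces the pairings at the two ends to be
    opposite.\<close>
  have "p / 2 + q / 2 = inner3 \<Omega> k (A_h \<Omega> \<T> fam k M) M"
    using inner3_A_h_lin_comb3[OF \<Omega> mesh P Q M, of "1 / 2" "1 / 2"] by (simp add: M_def[symmetric] p_def q_def)
  also have "\<dots> = 0"
    by (rule inner3_A_h_self[OF \<Omega> mesh M])
  finally have q: "q = - p"
    by simp
  have integrand: "inner3 \<Omega> k (time_deriv3 U t) M + inner3 \<Omega> k (A_h \<Omega> \<T> fam k (U t)) M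
      = c + (e + s - 2 * t) * (p / (e - s))" if t: "t \<in> {s<..<e}" for t
  proof -
    have "inner3 \<Omega> k (time_deriv3 U t) M =
        - 1 / (e - s) * inner3 \<Omega> k (U s) M + 1 / (e - s) * inner3 \<Omega> k (U e) M"
      using P1_time_interpolation(2)[OF U i T] t inner3_lin_comb3_left[OF P Q M] by (simp add: s_def e_def)
    also have "inner3 \<Omega> k (U s) M = (norm3 \<Omega> k (U s))\<^sup>2 / 2 + inner3 \<Omega> k (U s) (U e) / 2"
      by (simp add: M_def inner3_lin_comb3_right[OF P Q P] norm3_square)
    also have "inner3 \<Omega> k (U e) M = inner3 \<Omega> k (U s) (U e) / 2 + (norm3 \<Omega> k (U e))\<^sup>2 / 2"
      by (simp add: M_def inner3_lin_comb3_right[OF P Q Q] norm3_square inner3_commute[of _ _ "U e" "U s"])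
    also have "- 1 / h * (x / 2 + r / 2) + 1 / h * (r / 2 + y / 2) = (y - x) / (2 * h)" for h x y r :: real
      by (cases "h = 0") (auto simp: field_simps)
    finally have 1: "inner3 \<Omega> k (time_deriv3 U t) M = c"
      by (simp only: c_def)
    have "inner3 \<Omega> k (A_h \<Omega> \<T> fam k (U t)) M = (e - t) / (e - s) * p + (t - s) / (e - s) * q"
      using P1_time_interpolation(1)[OF U i T, of t] t inner3_A_h_lin_comb3[OF \<Omega> mesh P Q M]
      by (simp add: s_def e_def p_def q_def)
    also have "\<dots> = (e + s - 2 * t) * (p / (e - s))"
      by (simp add: q add_divide_distrib[symmetric] diff_divide_distrib[symmetric] algebra_simps)
    finally show ?thesis
      using 1 by simp
  qed
  have "{s<..<e} \<subseteq> {0..T}"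
    using \<open>0 \<le> s\<close> \<open>e \<le> T\<close> by auto
  then have ind: "indicat_real {0..T} t *\<^sub>R g t = indicat_real {s<..<e} t *\<^sub>R g' t"
    if "t \<in> {s<..<e} \<Longrightarrow> g t = g' t" "t \<notin> {s<..<e} \<Longrightarrow> g t = 0" for g g' :: "real \<Rightarrow> real" and t
    using that by (auto simp: indicator_def)
  have "(LINT t:{0..T}|lebesgue. inner3 \<Omega> k (time_deriv3 U t) (V t) + inner3 \<Omega> k (A_h \<Omega> \<T> fam k (U t)) (V t)) =
      (LINT t:{s<..<e}|lebesgue. c + (e + s - 2 * t) * (p / (e - s)))"
    unfolding set_lebesgue_integral_def
    by (intro Bochner_Integration.integral_cong refl ind) (simp_all add: V_def integrand Z0 del: greaterThanLessThan_iff)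
  also have "\<dots> = (e - s) * c"
    by (rule set_integral_affine_symmetric[OF \<open>s < e\<close>])
  also have "\<dots> = ((norm3 \<Omega> k (U e))\<^sup>2 - (norm3 \<Omega> k (U s))\<^sup>2) / 2"
  proof -
    have "h * (x / (2 * h)) = x / 2" if "h > 0" for h x :: real
      using that by simp
    then show ?thesis
      unfolding c_def using \<open>s < e\<close> by (metis diff_gt_0_iff_gt)
  qed
  finally have "((norm3 \<Omega> k (U e))\<^sup>2 - (norm3 \<Omega> k (U s))\<^sup>2) / 2 =
      (LINT t:{0..T}|lebesgue. inner3 \<Omega> k (source3 f t) (V t))"
    using test by simp
  also have "\<dots> = (LINT t:{s<..<e}|lebesgue. form_inner \<Omega> k (f t) (fst (snd M)))"
    unfolding set_lebesgue_integral_def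
    by (intro Bochner_Integration.integral_cong refl ind)
       (simp_all add: V_def Z0 inner3_source3[symmetric] del: greaterThanLessThan_iff)
  finally show ?thesis
    by (simp add: M_def lin_comb3_def)
qed

text \<open>The absolute value on the left makes the step usable for conservation as well. Half-open
  intervals are chosen so that consecutive steps fit together as a disjoint union.\<close>

lemma norm3_step:
  assumes \<Omega>: "open \<Omega>" "bounded \<Omega>" and mesh: "triangulation_of \<T> \<Omega>"
    and T: "T > 0" and f: "f \<in> Linfty_L2 T \<Omega> k"
    and sol: "fully_discrete_solution T N \<Omega> \<T> fam k (source3 f) U0 U"
    and i: "i \<in> {1..N}"
  defines "s \<equiv> time_node T N (i - 1)" and "e \<equiv> time_node T N i"
  shows "\<bar>norm3 \<Omega> k (U e) - norm3 \<Omega> k (U s)\<bar> \<le> (LINT t:{s<..e}|lebesgue. form_norm \<Omega> k (f t))"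
proof -
  let ?m = "lin_comb (1 / 2) (fst (snd (U s))) (1 / 2) (fst (snd (U e)))"
  let ?P = "norm3 \<Omega> k (U s)" and ?Q = "norm3 \<Omega> k (U e)"
  let ?I = "LINT t:{s<..e}|lebesgue. form_norm \<Omega> k (f t)"
  have "0 \<le> s"
    using T by (simp add: s_def time_node_def)
  have "s \<le> e"
    using time_node_mono[OF T, of "i - 1" i N] by (simp add: s_def e_def)
  have "e \<le> T"
    using time_node_mono[OF T, of i N N] i by (simp add: e_def time_node_def)
  have "U s \<in> fe_space3 \<Omega> \<T> fam k" "U e \<in> fe_space3 \<Omega> \<T> fam k"
    using sol \<open>0 \<le> s\<close> \<open>s \<le> e\<close> \<open>e \<le> T\<close> by (auto simp: fully_discrete_solution_def P1_time_def)
  then have L2: "fst (snd (U s)) \<in> L2_forms \<Omega> k" "fst (snd (U e)) \<in> L2_forms \<Omega> k"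
    by (auto simp: fe_space3_iff intro: fe_space_L2)
  have int: "set_integrable lebesgue {s<..e} (\<lambda>t. form_norm \<Omega> k (f t))"
    by (rule set_integrable_subset[OF Linfty_L2_norm_integrable[OF f]])
       (use \<open>0 \<le> s\<close> \<open>e \<le> T\<close> in auto)
  have I: "0 \<le> ?I"
    unfolding set_lebesgue_integral_def by (simp add: form_norm_nonneg)
  have m: "form_norm \<Omega> k ?m \<le> (?P + ?Q) / 2"
    using form_norm_lin_comb_le[OF L2, of "1 / 2" "1 / 2"] form_norm_le_norm3[of \<Omega> k "U s"]
      form_norm_le_norm3[of \<Omega> k "U e"] by simp
  have "AE t in lebesgue_on {0<..<T}. f t \<in> L2_forms \<Omega> k"
    using f unfolding Linfty_L2_def by (elim CollectE conjE)
  then have f_L2: "AE t in lebesgue. t \<in> {0<..<T} \<longrightarrow> f t \<in> L2_forms \<Omega> k"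
    by (simp add: AE_restrict_space_iff)
  have identity: "(?Q\<^sup>2 - ?P\<^sup>2) / 2 = (LINT t:{s<..<e}|lebesgue. form_inner \<Omega> k (f t) ?m)"
    unfolding s_def e_def by (rule energy_identity[OF \<Omega> mesh T sol i])
  have "\<bar>?Q\<^sup>2 - ?P\<^sup>2\<bar> / 2 = \<bar>LINT t:{s<..<e}|lebesgue. form_inner \<Omega> k (f t) ?m\<bar>"
    unfolding identity[symmetric] by simp
  \<comment> \<open>Measurability of the pairing in time is not established. A nonintegrable
    integrand has integral 0 by convention, so the bound holds in either case, and the comparison
    after it rests on integrability of the majorant.\<close>
  also have "\<dots> \<le> (LINT t|lebesgue. \<bar>indicator {s<..<e} t *\<^sub>R form_inner \<Omega> k (f t) ?m\<bar>)"
    unfolding set_lebesgue_integral_def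
    using integral_norm_bound[of lebesgue "\<lambda>t. indicator {s<..<e} t *\<^sub>R form_inner \<Omega> k (f t) ?m"] by simp
  also have "\<dots> \<le> (LINT t|lebesgue. (indicator {s<..e} t *\<^sub>R form_norm \<Omega> k (f t)) * form_norm \<Omega> k ?m)"
  proof (rule integral_mono_AE')
    show "integrable lebesgue (\<lambda>t. (indicator {s<..e} t *\<^sub>R form_norm \<Omega> k (f t)) * form_norm \<Omega> k ?m)"
      using int unfolding set_integrable_def by (rule integrable_mult_left)
    show "AE t in lebesgue. \<bar>indicator {s<..<e} t *\<^sub>R form_inner \<Omega> k (f t) ?m\<bar>
        \<le> (indicator {s<..e} t *\<^sub>R form_norm \<Omega> k (f t)) * form_norm \<Omega> k ?m"
      using f_L2
    proof eventually_elim
      case (elim t)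
      show ?case
      proof (cases "t \<in> {s<..<e}")
        case True
        then have "f t \<in> L2_forms \<Omega> k"
          using elim \<open>0 \<le> s\<close> \<open>e \<le> T\<close> by simp
        then show ?thesis
          using True form_inner_Cauchy_Schwarz[OF _ L2_forms_lin_comb[OF L2]] by simp
      next
        case False
        then show ?thesis
          by (simp add: form_norm_nonneg del: greaterThanLessThan_iff)
      qed
    qed
  qed (simp add: form_norm_nonneg)
  also have "\<dots> = ?I * form_norm \<Omega> k ?m"
    by (simp add: set_lebesgue_integral_def)
  also have "\<dots> \<le> ?I * ((?P + ?Q) / 2)"
    by (rule mult_left_mono[OF m I])
  finally have "\<bar>?Q\<^sup>2 - ?P\<^sup>2\<bar> \<le> ?I * (?P + ?Q)"
    by simp
  moreover have "\<bar>?Q\<^sup>2 - ?P\<^sup>2\<bar> = \<bar>?Q - ?P\<bar> * (?P + ?Q)"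
  proof -
    have "?Q\<^sup>2 - ?P\<^sup>2 = (?Q - ?P) * (?P + ?Q)"
      by (simp add: power2_eq_square algebra_simps)
    then show ?thesis
      by (simp add: abs_mult norm3_nonneg)
  qed
  ultimately have le: "\<bar>?Q - ?P\<bar> * (?P + ?Q) \<le> ?I * (?P + ?Q)"
    by simp
  show ?thesis
  \<comment> \<open>The common factor can be cancelled only when it is positive; otherwise both
    norms are 0.\<close>
  proof (cases "?P + ?Q = 0")
    case True
    then have "?P = 0" "?Q = 0"
      using norm3_nonneg[of \<Omega> k "U s"] norm3_nonneg[of \<Omega> k "U e"] by linarith+
    then show ?thesis
      using I by simp
  next
    case False
    then have "0 < ?P + ?Q"
      using norm3_nonneg[of \<Omega> k "U s"] norm3_nonneg[of \<Omega> k "U e"] by linarith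
    then show ?thesis
      using le by simp
  qed
qed

theorem theorem4p2:
  fixes \<Omega> :: "(real ^ 'n) set" and \<T> :: "(real ^ 'n) set set"
    and T \<gamma> :: real and N :: nat and k :: int and fam :: fe_family
    and f :: "real \<Rightarrow> (real ^ 'n) form"
    and U0 :: "(real ^ 'n) form3" and U :: "real \<Rightarrow> (real ^ 'n) form3"
  assumes n: "CARD('n) \<ge> 2"
    and k: "0 \<le> k" "k \<le> int CARD('n)"
    and T: "T > 0" and N: "N \<ge> 1"
    and \<Omega>: "admissible_domain \<Omega>"
    and mesh: "triangulation_of \<T> \<Omega>" "shape_regular \<gamma> \<T>"
    and U0: "U0 \<in> fe_space3 \<Omega> \<T> fam k"
    and f: "f \<in> Linfty_L2 T \<Omega> k"
    and sol: "fully_discrete_solution T N \<Omega> \<T> fam k (source3 f) U0 U"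
  shows "(MAX i\<in>{0..N}. norm3 \<Omega> k (U (time_node T N i)))
           \<le> norm3 \<Omega> k U0 + 2 * (LINT t:{0..T}|lebesgue. norm3 \<Omega> k (source3 f t)) \<and>
         ((AE t in lebesgue_on {0<..<T}. AE x in lebesgue_on \<Omega>. f t x = (\<lambda>vs. 0)) \<longrightarrow>
           (MAX i\<in>{0..N}. norm3 \<Omega> k (U (time_node T N i)))
             = norm3 \<Omega> k U0 + 2 * (LINT t:{0..T}|lebesgue. norm3 \<Omega> k (source3 f t)) \<and>
           (\<forall>i\<in>{1..N}. norm3 \<Omega> k (U (time_node T N i)) = norm3 \<Omega> k U0))"
proof -
  have dom: "open \<Omega>" "bounded \<Omega>"
    using \<Omega> by (auto simp: admissible_domain_def)
  let ?u = "\<lambda>i. norm3 \<Omega> k (U (time_node T N i))" and ?f = "\<lambda>t. form_norm \<Omega> k (f t)"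
  have u0: "?u 0 = norm3 \<Omega> k U0"
    using sol by (simp add: fully_discrete_solution_def time_node_def)
  note step = norm3_step[OF dom mesh(1) T f sol]
  have int: "set_integrable lebesgue A ?f" if "A \<subseteq> {0..T}" "A \<in> sets lebesgue" for A
    by (rule set_integrable_subset[OF Linfty_L2_norm_integrable[OF f] that(2,1)])
  have node: "0 \<le> time_node T N i" "i \<le> N \<Longrightarrow> time_node T N i \<le> T" for i
    using time_node_mono[OF T, of i N N] T N by (auto simp: time_node_def)
  have bound: "?u i \<le> norm3 \<Omega> k U0 + (LINT t:{0..time_node T N i}|lebesgue. ?f t)" if "i \<le> N" for i
    using that
  proof (induction i)
    case 0
    show ?case
      using u0 by (simp add: set_lebesgue_integral_def form_norm_nonneg)
  next
    case (Suc i)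
    let ?s = "time_node T N i" and ?e = "time_node T N (Suc i)"
    have "{0..?e} = {0..?s} \<union> {?s<..?e}"
      using node(1)[of i] time_node_mono[OF T, of i "Suc i" N] by auto
    moreover have "(LINT t:{0..?s} \<union> {?s<..?e}|lebesgue. ?f t) =
        (LINT t:{0..?s}|lebesgue. ?f t) + (LINT t:{?s<..?e}|lebesgue. ?f t)"
      using Suc.prems node[of i] node(2)[of "Suc i"] by (intro set_integral_Un int) auto
    moreover have "?u (Suc i) \<le> ?u i + (LINT t:{?s<..?e}|lebesgue. ?f t)"
      using step[of "Suc i"] Suc.prems by simp
    ultimately show ?case
      using Suc by simp
  qed
  have mono: "(LINT t:{0..time_node T N i}|lebesgue. ?f t) \<le> (LINT t:{0..T}|lebesgue. ?f t)" if "i \<le> N" for i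
    unfolding set_lebesgue_integral_def
    using int[of "{0..T}"] node[of i] that
    by (intro integral_mono_AE' AE_I2) (auto simp: set_integrable_def form_norm_nonneg indicator_def)
  have nonneg: "0 \<le> (LINT t:{0..T}|lebesgue. ?f t)"
    by (simp add: set_lebesgue_integral_def form_norm_nonneg)
  have max_le: "(MAX i\<in>{0..N}. ?u i) \<le> norm3 \<Omega> k U0 + 2 * (LINT t:{0..T}|lebesgue. ?f t)"
  proof (rule Max.boundedI)
    fix x assume "x \<in> ?u ` {0..N}"
    then obtain i where "x = ?u i" "i \<le> N"
      by auto
    \<comment> \<open>Summing the steps produces the source integral once; its nonnegativity pays
      for the second copy.\<close>
    then show "x \<le> norm3 \<Omega> k U0 + 2 * (LINT t:{0..T}|lebesgue. ?f t)"
      using bound[of i] mono[of i] nonneg by linarith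
  qed auto
  have zero: "(MAX i\<in>{0..N}. ?u i) = norm3 \<Omega> k U0 + 2 * (LINT t:{0..T}|lebesgue. ?f t) \<and>
      (\<forall>i\<in>{1..N}. ?u i = norm3 \<Omega> k U0)"
    if f0: "AE t in lebesgue_on {0<..<T}. AE x in lebesgue_on \<Omega>. f t x = (\<lambda>vs. 0)"
  proof -
    have "AE t in lebesgue_on {0<..<T}. ?f t = 0"
      using f0
    proof eventually_elim
      case (elim t)
      then have "AE x in lebesgue_on \<Omega>. alt_inner k (f t x) (f t x) = 0"
        by eventually_elim (simp add: alt_inner_def)
      then show ?case
        by (simp add: form_norm_def form_inner_def integral_eq_zero_AE)
    qed
    then have "AE t in lebesgue. t \<in> {0<..<T} \<longrightarrow> ?f t = 0"
      by (simp add: AE_restrict_space_iff)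
    \<comment> \<open>The source is assumed to vanish only inside the time interval, so the
      endpoints are discarded as a null set.\<close>
    moreover have "AE t in lebesgue. t \<noteq> 0" "AE t in lebesgue. t \<noteq> T"
      by (auto intro!: AE_completion AE_lborel_singleton)
    ultimately have "AE t in lebesgue. t \<in> {0..T} \<longrightarrow> ?f t = 0"
      by eventually_elim auto
    then have 0: "(LINT t:A|lebesgue. ?f t) = 0" if "A \<subseteq> {0..T}" for A
      unfolding set_lebesgue_integral_def
      by (intro integral_eq_zero_AE) (auto elim!: eventually_mono simp: indicator_def dest: subsetD[OF that])
    \<comment> \<open>With vanishing source integrals each two-sided step estimate forces equality
      of neighbouring norms.\<close>
    have all: "?u i = norm3 \<Omega> k U0" if "i \<le> N" for i
      using that
    proof (induction i)
      case (Suc i)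
      have "{time_node T N i<..time_node T N (Suc i)} \<subseteq> {0..T}"
        using node(1)[of i] node(2)[of "Suc i"] Suc.prems by auto
      then show ?case
        using step[of "Suc i"] 0 Suc by simp
    qed (rule u0)
    then have "?u ` {0..N} = {norm3 \<Omega> k U0}"
      by force
    then show ?thesis
      using 0[of "{0..T}"] all by simp
  qed
  show ?thesis
    unfolding norm3_source3 by (rule conjI[OF max_le], rule impI, rule zero)
qed

end
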